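(* Let $n$ and $s$ be positive integers, and assume that there exists a tight symmetric inner distribution code for the Johnson scheme $J(2n,n)$ of degree $s$. Then either $s=1$, or $s=n-1$, or $s>0.9999995\,n$. In particular, if $n\le 4{,}000{,}000$, then $s=1$ or $s=n-1$.
   Context: The Johnson scheme $J(2n,n)$ has point set $\binom{[2n]}{n}$, the $n$-element subsets of $[2n]=\{1,\ldots,2n\}$, with distance $d_J(x,y)=n-|x\cap y|$. For a code $C\subseteq\binom{[2n]}{n}$, the degree set is $S(C)=\{d_J(x,y):x,y\in C,\ x\ne y\}$ and the degree is $|S(C)|$. The code $C$ is a symmetric inner distribution code if $a\in S(C)$ implies $n-a\in S(C)$. A symmetric inner distribution code $C$ of degree $s$ in $J(2n,n)$ is tight if $|C|=\binom{2n-1}{s}$. *)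

theory Defs
  imports Complex_Main
begin

definition johnson_points :: "nat \<Rightarrow> nat set set" where
  "johnson_points n = {x. x \<subseteq> {1..2 * n} \<and> card x = n}"

(* The subtraction on nat never truncates on points x, y of the scheme,
   since there card (x \<inter> y) \<le> n. *)
definition johnson_dist :: "nat \<Rightarrow> nat set \<Rightarrow> nat set \<Rightarrow> nat" where
  "johnson_dist n x y = n - card (x \<inter> y)"

definition degree_set :: "nat \<Rightarrow> nat set set \<Rightarrow> nat set" where
  "degree_set n C = {johnson_dist n x y | x y. x \<in> C \<and> y \<in> C \<and> x \<noteq> y}"

definition code_degree :: "nat \<Rightarrow> nat set set \<Rightarrow> nat" where
  "code_degree n C = card (degree_set n C)"

(* As every element of the degree set is positive, the symmetry condition
   excludes the distance n, i.e. complementary pairs in C. *)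
definition symmetric_inner_distribution_code :: "nat \<Rightarrow> nat set set \<Rightarrow> bool" where
  "symmetric_inner_distribution_code n C \<longleftrightarrow>
     C \<subseteq> johnson_points n \<and> (\<forall>a \<in> degree_set n C. n - a \<in> degree_set n C)"

definition tight_symmetric_inner_distribution_code :: "nat \<Rightarrow> nat \<Rightarrow> nat set set \<Rightarrow> bool" where
  "tight_symmetric_inner_distribution_code n s C \<longleftrightarrow>
     symmetric_inner_distribution_code n C \<and> code_degree n C = s \<and>
     card C = (2 * n - 1) choose s"

end

theory Submission
  imports Defs "Jordan_Normal_Form.Determinant"
begin

text \<open>Replacing every codeword that misses the point 2n by its complement turns a tight symmetric inner
distribution code of degree s into a family of (n-1)-subsets of a (2n-1)-set that has s
intersection numbers and attains the Ray-Chaudhuri--Wilson bound (2n-1 choose s)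
(\<open>code_folding\<close>). In such a family the annihilator functions of the members form a basis of the
functions of degree at most s on the slice, so they act as a reproducing kernel
(\<open>tight_code_reproduces\<close>), and averaging over the slice shows that the polynomial p whose zeros
are the intersection numbers is orthogonal to all polynomials of lower degree with respect to the
weight (n-1 choose x)(n-1 choose x+1) on 0,...,n-2 (\<open>tight_code_intersection_polynomial\<close>).
Thus p is a symmetric Hahn polynomial all of whose zeros are integers, and the point of the proof is
that no such polynomial exists for 2 \<le> s \<le> n-2; so s=1 or s=n-1.

Orthogonality makes p an eigenfunction of a second-order difference operator
(\<open>orthogonal_polynomial_eigenfunction\<close>), and this is used twice.

Arithmetic: the expansion of p in falling factorials has explicit coefficients, which must be
integers because the zeros are. Already the second coefficient forces 2(n-s)+1 to divide
3s(s-1)/2, so n is at most of order s^2.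

Oscillation: since the zeros are integers, p never changes sign strictly between two neighbouring
integers. A Sturm comparison then shows that the gaps between consecutive zeros strictly increase
away from the centre (\<open>gap_strict_increase\<close>). Being integers they increase by at least one each
time, which pushes the outer zeros to a distance of order s^2 from the centre. Oscillation however
stops at a distance of order sqrt(ns) (\<open>non_oscillation_bound\<close>), so n is at least of order
s^3 (\<open>root_spread\<close>).

The two bounds collide unless s \<le> 27. The finitely many remaining pairs (n,s) fail the
integrality of one of the first four coefficients or the spread inequality
(\<open>integral_coefficients_contradiction\<close>).\<close>

section \<open>Polynomial functions on the slices of a set\<close>

definition slice :: "'a set \<Rightarrow> nat \<Rightarrow> 'a set set" where
  "slice V k = {x. x \<subseteq> V \<and> card x = k}"

text \<open>Membership in the space of functions on the slice of degree at most j. For j \<le> k the monomials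
of degree exactly j already span it, since lower ones are combinations of them on the slice
(\<open>slice_poly_lift\<close>); this keeps the size of the spanning family at (|V| choose j).\<close>

definition slice_poly :: "'a set \<Rightarrow> nat \<Rightarrow> nat \<Rightarrow> ('a set \<Rightarrow> real) \<Rightarrow> bool" where
  "slice_poly V k j g \<longleftrightarrow>
     (\<exists>\<phi>. \<forall>x\<in>slice V k. g x = (\<Sum>T\<in>slice V j. \<phi> T * of_bool (T \<subseteq> x)))"

lemma finite_slice: "finite V \<Longrightarrow> finite (slice V k)"
  by (simp add: slice_def)

lemma card_slice: "finite V \<Longrightarrow> card (slice V k) = card V choose k"
  by (simp add: slice_def n_subsets)

lemma slice_poly_cong:
  "slice_poly V k j g \<Longrightarrow> (\<And>x. x \<in> slice V k \<Longrightarrow> h x = g x) \<Longrightarrow> slice_poly V k j h"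
  unfolding slice_poly_def by metis

lemma slice_poly_indicator:
  assumes "finite V" "U \<in> slice V j"
  shows "slice_poly V k j (\<lambda>x. of_bool (U \<subseteq> x))"
proof -
  have "of_bool (U \<subseteq> x) = (\<Sum>T\<in>slice V j. (of_bool (T = U) :: real) * of_bool (T \<subseteq> x))" for x
  proof -
    have "(\<Sum>T\<in>slice V j. (of_bool (T = U) :: real) * of_bool (T \<subseteq> x)) =
          (\<Sum>T\<in>slice V j. if T = U then of_bool (T \<subseteq> x) else 0)"
      by (intro sum.cong) auto
    then show ?thesis using assms by (simp add: finite_slice sum.delta)
  qed
  then show ?thesis unfolding slice_poly_def by (intro exI[of _ "\<lambda>T. of_bool (T = U)"]) auto
qed

lemma slice_poly_scale:
  assumes "slice_poly V k j g" shows "slice_poly V k j (\<lambda>x. c * g x)"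
proof -
  obtain \<phi> where "\<forall>x\<in>slice V k. g x = (\<Sum>T\<in>slice V j. \<phi> T * of_bool (T \<subseteq> x))"
    using assms unfolding slice_poly_def by blast
  then show ?thesis unfolding slice_poly_def
    by (intro exI[of _ "\<lambda>T. c * \<phi> T"]) (simp add: sum_distrib_left mult.assoc)
qed

lemma slice_poly_sum:
  assumes "\<And>i. i \<in> I \<Longrightarrow> slice_poly V k j (g i)"
  shows "slice_poly V k j (\<lambda>x. \<Sum>i\<in>I. g i x)"
proof -
  have "\<forall>i\<in>I. \<exists>\<phi>. \<forall>x\<in>slice V k. g i x = (\<Sum>T\<in>slice V j. \<phi> T * of_bool (T \<subseteq> x))"
    using assms unfolding slice_poly_def by blast
  then obtain \<phi> where \<phi>: "\<forall>i\<in>I. \<forall>x\<in>slice V k. g i x = (\<Sum>T\<in>slice V j. \<phi> i T * of_bool (T \<subseteq> x))"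
    by metis
  have "(\<Sum>i\<in>I. g i x) = (\<Sum>T\<in>slice V j. (\<Sum>i\<in>I. \<phi> i T) * of_bool (T \<subseteq> x))" if "x \<in> slice V k" for x
  proof -
    have "(\<Sum>i\<in>I. g i x) = (\<Sum>i\<in>I. \<Sum>T\<in>slice V j. \<phi> i T * of_bool (T \<subseteq> x))"
      using \<phi> that by (intro sum.cong) auto
    also have "\<dots> = (\<Sum>T\<in>slice V j. \<Sum>i\<in>I. \<phi> i T * of_bool (T \<subseteq> x))"
      by (rule sum.swap)
    finally show ?thesis by (simp add: sum_distrib_right)
  qed
  then show ?thesis unfolding slice_poly_def by (intro exI[of _ "\<lambda>T. \<Sum>i\<in>I. \<phi> i T"]) auto
qed

text \<open>Multiplying the monomial of T by \<Sum>i\<in>x. w_i splits the sum into i \<in> T and i \<notin> T.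
The second part consists of monomials of degree j+1; the first part is a multiple of the monomial
of T, which is raised to degree j+1 by averaging over the k-j points of x - T.\<close>

lemma slice_poly_times_linear:
  assumes V: "finite V" and jk: "j < k" and g: "slice_poly V k j g"
  shows "slice_poly V k (Suc j) (\<lambda>x. (\<Sum>i\<in>x. w i) * g x)"
proof -
  obtain \<phi> where \<phi>: "\<And>x. x \<in> slice V k \<Longrightarrow> g x = (\<Sum>T\<in>slice V j. \<phi> T * of_bool (T \<subseteq> x))"
    using g unfolding slice_poly_def by blast
  define c where "c T = (\<Sum>i\<in>T. w i) / (real k - real j)" for T
  have key: "(\<Sum>i\<in>x. w i) * of_bool (T \<subseteq> x) =
      (\<Sum>i\<in>V - T. (w i + c T) * of_bool (insert i T \<subseteq> x))"
    if x: "x \<in> slice V k" and T: "T \<in> slice V j" for x T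
  proof (cases "T \<subseteq> x")
    case True
    have fin: "finite x" "finite T" and card: "card x = k" "card T = j" and sub: "x \<subseteq> V"
      using x T V by (auto simp: slice_def intro: finite_subset)
    have "(\<Sum>i\<in>V - T. (w i + c T) * of_bool (insert i T \<subseteq> x)) = (\<Sum>i\<in>x - T. w i + c T)"
      using True sub V by (intro sum.mono_neutral_cong_right) auto
    also have "\<dots> = (\<Sum>i\<in>x. w i) - (\<Sum>i\<in>T. w i) + real (card (x - T)) * c T"
      using True fin by (simp add: sum.distrib sum_diff)
    also have "real (card (x - T)) = real k - real j"
      using True fin card jk by (simp add: card_Diff_subset of_nat_diff)
    also have "(real k - real j) * c T = (\<Sum>i\<in>T. w i)"
      using jk by (simp add: c_def)
    finally show ?thesis using True by simp
  next
    case False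
    then show ?thesis by (simp add: sum.neutral)
  qed
  have "slice_poly V k (Suc j)
     (\<lambda>x. \<Sum>T\<in>slice V j. \<phi> T * (\<Sum>i\<in>V - T. (w i + c T) * of_bool (insert i T \<subseteq> x)))"
  proof (intro slice_poly_sum slice_poly_scale slice_poly_indicator V)
    fix T i assume "T \<in> slice V j" "i \<in> V - T"
    then show "insert i T \<in> slice V (Suc j)"
      using V by (auto simp: slice_def card_insert_if dest: finite_subset)
  qed
  then show ?thesis
  proof (rule slice_poly_cong)
    fix x assume x: "x \<in> slice V k"
    have "(\<Sum>i\<in>x. w i) * g x = (\<Sum>T\<in>slice V j. \<phi> T * ((\<Sum>i\<in>x. w i) * of_bool (T \<subseteq> x)))"
      unfolding \<phi>[OF x] by (simp add: sum_distrib_left mult_ac)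
    also have "\<dots> = (\<Sum>T\<in>slice V j. \<phi> T * (\<Sum>i\<in>V - T. (w i + c T) * of_bool (insert i T \<subseteq> x)))"
      by (intro sum.cong refl) (simp only: key[OF x])
    finally show "(\<Sum>i\<in>x. w i) * g x = \<dots>" .
  qed
qed

text \<open>On the slice the constant c equals \<Sum>i\<in>x. c/k, so this factor is a homogeneous linear form.\<close>

lemma slice_poly_times_intersection:
  assumes V: "finite V" and jk: "j < k" and g: "slice_poly V k j g"
  shows "slice_poly V k (Suc j) (\<lambda>x. (real (card (b \<inter> x)) - c) * g x)"
proof (rule slice_poly_cong[OF slice_poly_times_linear[OF assms, of "\<lambda>i. of_bool (i \<in> b) - c / real k"]])
  fix x assume "x \<in> slice V k"
  then have x: "finite x" "card x = k" using V by (auto simp: slice_def intro: finite_subset)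
  have "(\<Sum>i\<in>x. (of_bool (i \<in> b) :: real)) = real (card (b \<inter> x))"
    using x by (simp add: Int_commute)
  then show "(real (card (b \<inter> x)) - c) * g x = (\<Sum>i\<in>x. of_bool (i \<in> b) - c / real k) * g x"
    using x jk by (simp add: sum_subtractf)
qed

lemma slice_poly_lift:
  assumes V: "finite V" and "j \<le> m" "m \<le> k" and g: "slice_poly V k j g"
  shows "slice_poly V k m g"
  using assms(2,3)
proof (induction m rule: dec_induct)
  case base then show ?case using g by simp
next
  case (step m)
  have "slice_poly V k (Suc m) (\<lambda>x. (\<Sum>i\<in>x. 1 / real k) * g x)"
    using step by (intro slice_poly_times_linear V) auto
  then show ?case by (rule slice_poly_cong) (use step in \<open>auto simp: slice_def\<close>)
qed

lemma slice_poly_prod_intersection: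
  assumes V: "finite V" and R: "finite R" and "card R \<le> k"
  shows "slice_poly V k (card R) (\<lambda>x. \<Prod>r\<in>R. (real (card (b \<inter> x)) - f r))"
  using R assms(3)
proof (induction R rule: finite_induct)
  case empty
  have "slice_poly V k 0 (\<lambda>x. of_bool ({} \<subseteq> x))"
    by (rule slice_poly_indicator) (auto simp: V slice_def)
  then show ?case by simp
next
  case (insert r R)
  then have "slice_poly V k (Suc (card R))
     (\<lambda>x. (real (card (b \<inter> x)) - f r) * (\<Prod>r\<in>R. (real (card (b \<inter> x)) - f r)))"
    by (intro slice_poly_times_intersection V) auto
  with insert show ?case by simp
qed

section \<open>Reproducing property and orthogonality of tight codes\<close>

text \<open>This is how tightness is used: the incidence matrix between codewords and monomials is square because
a tight code has exactly as many members as there are monomials.\<close>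

lemma square_left_inverse_imp_right_inverse:
  fixes M :: "'a \<Rightarrow> 'b \<Rightarrow> real" and N :: "'b \<Rightarrow> 'a \<Rightarrow> real"
  assumes fin: "finite A" "finite B" and eq: "card A = card B"
    and inv: "\<And>a a'. a \<in> A \<Longrightarrow> a' \<in> A \<Longrightarrow> (\<Sum>b\<in>B. M a b * N b a') = of_bool (a = a')"
    and b: "b \<in> B" "b' \<in> B"
  shows "(\<Sum>a\<in>A. N b a * M a b') = of_bool (b = b')"
proof -
  define n where "n = card A"
  obtain e where e: "bij_betw e {0..<n} A" using ex_bij_betw_nat_finite[OF fin(1)] unfolding n_def by blast
  obtain h where h: "bij_betw h {0..<n} B" using ex_bij_betw_nat_finite[OF fin(2)] unfolding n_def eq by blast
  define M' where "M' = mat n n (\<lambda>(i,j). M (e i) (h j))"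
  define N' where "N' = mat n n (\<lambda>(i,j). N (h i) (e j))"
  have inj: "e i = e j \<longleftrightarrow> i = j" "h i = h j \<longleftrightarrow> i = j" if "i < n" "j < n" for i j
    using that bij_betw_imp_inj_on[OF e] bij_betw_imp_inj_on[OF h] by (simp_all add: inj_on_eq_iff)
  have "M' * N' = 1\<^sub>m n"
  proof (rule eq_matI)
    fix i j assume ij: "i < dim_row (1\<^sub>m n :: real mat)" "j < dim_col (1\<^sub>m n :: real mat)"
    then have "(M' * N') $$ (i,j) = (\<Sum>l\<in>{0..<n}. M (e i) (h l) * N (h l) (e j))"
      by (simp add: M'_def N'_def scalar_prod_def)
    also have "\<dots> = (\<Sum>b\<in>B. M (e i) b * N b (e j))"
      by (rule sum.reindex_bij_betw[OF h])
    also have "\<dots> = of_bool (e i = e j)"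
      using ij bij_betwE[OF e] by (intro inv) simp_all
    finally show "(M' * N') $$ (i,j) = 1\<^sub>m n $$ (i,j)" using ij inj by simp
  qed (auto simp: M'_def N'_def)
  moreover have "M' \<in> carrier_mat n n" "N' \<in> carrier_mat n n"
    by (simp_all add: M'_def N'_def)
  ultimately have NM: "N' * M' = 1\<^sub>m n"
    using mat_mult_left_right_inverse by blast
  obtain i j where ij: "i < n" "j < n" "b = h i" "b' = h j"
    using b bij_betw_imp_surj_on[OF h] by fastforce
  have "(\<Sum>a\<in>A. N b a * M a b') = (\<Sum>l\<in>{0..<n}. N (h i) (e l) * M (e l) (h j))"
    unfolding ij by (rule sum.reindex_bij_betw[OF e, symmetric])
  also have "\<dots> = (N' * M') $$ (i,j)"
    using ij by (simp add: M'_def N'_def scalar_prod_def)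
  finally show ?thesis using ij inj by (simp add: NM)
qed

text \<open>Up to the factor \<Prod>r\<in>R. (k-r) the annihilators b \<mapsto> \<Prod>r\<in>R. (|a \<inter> b|-r) of the
codewords a are dual to evaluation at the codewords. Writing them in the monomials of degree
|R| gives a one-sided inverse of the incidence matrix between codewords and monomials; by
tightness that matrix is square, so the inverse is two-sided, which says that the annihilators
reproduce every monomial and hence every function of degree at most |R|.\<close>

lemma tight_code_reproduces:
  assumes V: "finite V" and R: "finite R" "card R \<le> k" "k \<notin> R"
    and C: "C \<subseteq> slice V k" "card C = card V choose card R"
    and dist: "\<And>a b. a \<in> C \<Longrightarrow> b \<in> C \<Longrightarrow> a \<noteq> b \<Longrightarrow> card (a \<inter> b) \<in> R"
    and g: "slice_poly V k (card R) g" and b: "b \<in> slice V k"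
  shows "(\<Prod>r\<in>R. real k - real r) * g b =
         (\<Sum>a\<in>C. g a * (\<Prod>r\<in>R. real (card (a \<inter> b)) - real r))"
proof -
  define F where "F a x = (\<Prod>r\<in>R. real (card (a \<inter> x)) - real r)" for a x :: "'a set"
  define K where "K = (\<Prod>r\<in>R. real k - real r)"
  define B where "B = slice V (card R)"
  have K: "K \<noteq> 0" using R by (auto simp: K_def)
  have fin: "finite C" "finite B"
    using C V finite_slice finite_subset unfolding B_def by blast+
  have "\<forall>a. \<exists>\<phi>. \<forall>x\<in>slice V k. F a x = (\<Sum>T\<in>B. \<phi> T * of_bool (T \<subseteq> x))"
    using slice_poly_prod_intersection[OF V R(1,2), of _ real]
    unfolding F_def B_def slice_poly_def by blast
  then obtain \<phi> where \<phi>: "\<And>a x. x \<in> slice V k \<Longrightarrow> F a x = (\<Sum>T\<in>B. \<phi> a T * of_bool (T \<subseteq> x))"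
    by metis
  obtain \<psi> where \<psi>: "\<And>x. x \<in> slice V k \<Longrightarrow> g x = (\<Sum>T\<in>B. \<psi> T * of_bool (T \<subseteq> x))"
    using g unfolding slice_poly_def B_def by blast
  have F_C: "F a a' = K * of_bool (a = a')" if "a \<in> C" "a' \<in> C" for a a'
  proof (cases "a = a'")
    case True
    then show ?thesis using that C by (auto simp: F_def K_def slice_def)
  next
    case False
    then have "card (a \<inter> a') \<in> R" using dist that by blast
    then have "\<exists>r\<in>R. real (card (a \<inter> a')) - real r = 0" by force
    then show ?thesis using False R unfolding F_def by (simp add: prod_zero_iff)
  qed
  have left: "(\<Sum>T\<in>B. \<phi> a T / K * of_bool (T \<subseteq> a')) = of_bool (a = a')" if "a \<in> C" "a' \<in> C" for a a'
  proof -
    have "a' \<in> slice V k" using that C by blast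
    then have "(\<Sum>T\<in>B. \<phi> a T / K * of_bool (T \<subseteq> a')) = F a a' / K"
      unfolding \<phi>[OF \<open>a' \<in> slice V k\<close>] sum_divide_distrib by (intro sum.cong) auto
    then show ?thesis using F_C[OF that] K by simp
  qed
  have card: "card C = card B" using C V by (simp add: B_def card_slice)
  have right: "(\<Sum>a\<in>C. of_bool (T \<subseteq> a) * (\<phi> a T' / K)) = of_bool (T = T')" if "T \<in> B" "T' \<in> B" for T T'
    using square_left_inverse_imp_right_inverse[OF fin card left that] .
  have "(\<Sum>a\<in>C. g a * F a b) =
        (\<Sum>a\<in>C. (\<Sum>T\<in>B. \<psi> T * of_bool (T \<subseteq> a)) * (\<Sum>T'\<in>B. \<phi> a T' * of_bool (T' \<subseteq> b)))"
    using C by (intro sum.cong refl) (simp only: \<psi> \<phi>[OF b] subsetD)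
  also have "\<dots> = (\<Sum>a\<in>C. \<Sum>T\<in>B. \<Sum>T'\<in>B. \<psi> T * of_bool (T' \<subseteq> b) * K * (of_bool (T \<subseteq> a) * (\<phi> a T' / K)))"
    unfolding sum_product using K by (intro sum.cong refl) simp
  also have "\<dots> = (\<Sum>T\<in>B. \<Sum>a\<in>C. \<Sum>T'\<in>B. \<psi> T * of_bool (T' \<subseteq> b) * K * (of_bool (T \<subseteq> a) * (\<phi> a T' / K)))"
    by (rule sum.swap)
  also have "\<dots> = (\<Sum>T\<in>B. \<Sum>T'\<in>B. \<Sum>a\<in>C. \<psi> T * of_bool (T' \<subseteq> b) * K * (of_bool (T \<subseteq> a) * (\<phi> a T' / K)))"
    by (rule sum.cong[OF refl], rule sum.swap)
  also have "\<dots> = (\<Sum>T\<in>B. \<Sum>T'\<in>B. \<psi> T * of_bool (T' \<subseteq> b) * K * of_bool (T = T'))"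
    unfolding sum_distrib_left[symmetric] by (intro sum.cong refl) (simp only: right)
  also have "\<dots> = (\<Sum>T\<in>B. \<Sum>T'\<in>B. if T = T' then \<psi> T * of_bool (T' \<subseteq> b) * K else 0)"
    by (intro sum.cong refl) auto
  also have "\<dots> = K * g b"
    unfolding \<psi>[OF b] sum_distrib_left using fin
    by (intro sum.cong refl) (simp add: sum.delta' mult_ac)
  finally show ?thesis by (simp add: F_def K_def)
qed

lemma sum_over_slice_by_intersection:
  assumes V: "finite V" and a: "a \<in> slice V k"
  shows "(\<Sum>b\<in>slice V k. h (card (a \<inter> b))) =
         (\<Sum>m\<le>k. real (k choose m) * real ((card V - k) choose (k - m)) * h m)"
proof -
  have fa: "finite a" "a \<subseteq> V" "card a = k" using a V by (auto simp: slice_def intro: finite_subset)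
  have count: "card {b \<in> slice V k. card (a \<inter> b) = m} = (k choose m) * ((card V - k) choose (k - m))"
    if "m \<le> k" for m
  proof -
    have "bij_betw (\<lambda>(x, y). x \<union> y) (slice a m \<times> slice (V - a) (k - m)) {b \<in> slice V k. card (a \<inter> b) = m}"
    proof (rule bij_betw_byWitness[where f' = "\<lambda>b. (a \<inter> b, b - a)"])
      show "\<forall>z\<in>slice a m \<times> slice (V - a) (k - m). (a \<inter> (case z of (x, y) \<Rightarrow> x \<union> y), (case z of (x, y) \<Rightarrow> x \<union> y) - a) = z"
        by (auto simp: slice_def)
      show "\<forall>b\<in>{b \<in> slice V k. card (a \<inter> b) = m}. (case (a \<inter> b, b - a) of (x, y) \<Rightarrow> x \<union> y) = b"
        by auto
      show "(\<lambda>(x, y). x \<union> y) ` (slice a m \<times> slice (V - a) (k - m)) \<subseteq> {b \<in> slice V k. card (a \<inter> b) = m}"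
      proof (clarify)
        fix x y assume x: "x \<in> slice a m" and y: "y \<in> slice (V - a) (k - m)"
        have "card (x \<union> y) = card x + card y"
          using x y fa V by (intro card_Un_disjoint) (auto simp: slice_def intro: finite_subset)
        moreover have "a \<inter> (x \<union> y) = x" using x y by (auto simp: slice_def)
        ultimately show "x \<union> y \<in> slice V k \<and> card (a \<inter> (x \<union> y)) = m"
          using x y fa that by (auto simp: slice_def)
      qed
      show "(\<lambda>b. (a \<inter> b, b - a)) ` {b \<in> slice V k. card (a \<inter> b) = m} \<subseteq> slice a m \<times> slice (V - a) (k - m)"
      proof (clarify)
        fix b assume b: "b \<in> slice V k"
        then have "finite b" using V by (auto simp: slice_def intro: finite_subset)
        then have "card (b - a) = card b - card (a \<inter> b)"
          by (simp add: card_Diff_subset_Int Int_commute)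
        then show "a \<inter> b \<in> slice a (card (a \<inter> b)) \<and> b - a \<in> slice (V - a) (k - card (a \<inter> b))"
          using b by (auto simp: slice_def)
      qed
    qed
    then have "card {b \<in> slice V k. card (a \<inter> b) = m} = card (slice a m \<times> slice (V - a) (k - m))"
      by (rule bij_betw_same_card[symmetric])
    moreover have "card (V - a) = card V - k" using fa by (simp add: card_Diff_subset)
    ultimately show ?thesis using fa V by (simp add: card_cartesian_product card_slice)
  qed
  have "(\<Sum>b\<in>slice V k. h (card (a \<inter> b))) = (\<Sum>m\<le>k. \<Sum>b\<in>{b \<in> slice V k. card (a \<inter> b) = m}. h (card (a \<inter> b)))"
  proof (rule sum.group[symmetric])
    show "(\<lambda>b. card (a \<inter> b)) ` slice V k \<subseteq> {..k}"
      using fa card_mono[of a "a \<inter> _"] by auto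
  qed (simp_all add: V finite_slice)
  also have "\<dots> = (\<Sum>m\<le>k. real (k choose m) * real ((card V - k) choose (k - m)) * h m)"
    by (intro sum.cong refl) (simp add: count)
  finally show ?thesis .
qed

text \<open>Apply the reproducing property at b to x \<mapsto> G(|b \<inter> x|), where the polynomial G contains
the factor t-k and so vanishes at x=b. The resulting identity holds for every b in the slice,
and summing over b replaces the sum over codewords by |C| times a sum over the slice.\<close>

lemma tight_code_orthogonality:
  assumes V: "finite V" and kV: "k \<le> card V" and R: "finite R" "card R \<le> k" "k \<notin> R"
    and C: "C \<subseteq> slice V k" "card C = card V choose card R"
    and dist: "\<And>a b. a \<in> C \<Longrightarrow> b \<in> C \<Longrightarrow> a \<noteq> b \<Longrightarrow> card (a \<inter> b) \<in> R"
    and i: "i < card R"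
  shows "(\<Sum>m\<le>k. real (k choose m) * real ((card V - k) choose (k - m)) *
           ((real m - real k) * (\<Prod>l<i. real m - real l) * (\<Prod>r\<in>R. real m - real r))) = 0"
    (is "?S = 0")
proof -
  define G where "G t = (real t - real k) * (\<Prod>l<i. real t - real l)" for t
  define H where "H m = G m * (\<Prod>r\<in>R. real m - real r)" for m
  have zero: "(\<Sum>a\<in>C. H (card (a \<inter> b))) = 0" if b: "b \<in> slice V k" for b
  proof -
    have "slice_poly V k (card {..<i}) (\<lambda>x. \<Prod>l<i. real (card (b \<inter> x)) - real l)"
      using i R by (intro slice_poly_prod_intersection V) auto
    then have "slice_poly V k (Suc i) (\<lambda>x. (real (card (b \<inter> x)) - real k) * (\<Prod>l<i. real (card (b \<inter> x)) - real l))"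
      using i R by (intro slice_poly_times_intersection V) auto
    then have "slice_poly V k (Suc i) (\<lambda>x. G (card (b \<inter> x)))" by (simp add: G_def)
    then have "slice_poly V k (card R) (\<lambda>x. G (card (b \<inter> x)))"
      using i R by (rule_tac slice_poly_lift[OF V]) auto
    from tight_code_reproduces[OF V R C dist this b]
    have "(\<Prod>r\<in>R. real k - real r) * G (card (b \<inter> b)) =
        (\<Sum>a\<in>C. G (card (b \<inter> a)) * (\<Prod>r\<in>R. real (card (a \<inter> b)) - real r))" by simp
    moreover have "G (card (b \<inter> b)) = 0" using b by (simp add: G_def slice_def)
    ultimately show ?thesis by (simp add: H_def Int_commute)
  qed
  have "0 = (\<Sum>b\<in>slice V k. \<Sum>a\<in>C. H (card (a \<inter> b)))" by (simp add: zero)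
  also have "\<dots> = (\<Sum>a\<in>C. \<Sum>b\<in>slice V k. H (card (a \<inter> b)))" by (rule sum.swap)
  also have "\<dots> = (\<Sum>a\<in>C. ?S)"
  proof (rule sum.cong[OF refl])
    fix a assume "a \<in> C"
    then have a: "a \<in> slice V k" using C by blast
    show "(\<Sum>b\<in>slice V k. H (card (a \<inter> b))) = ?S"
      unfolding sum_over_slice_by_intersection[OF V a] by (simp add: H_def G_def)
  qed
  also have "\<dots> = real (card C) * ?S" by simp
  finally have "real (card C) * ?S = 0" by simp
  moreover have "card C > 0" using C(2) R kV by simp
  ultimately show ?thesis by simp
qed

text \<open>The factor m-(n-1) is absorbed into a binomial coefficient, which turns the valency weight of the
slice into the symmetric weight (n-1 choose m)(n-1 choose m+1).\<close>

lemma hahn_weight_orthogonality: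
  fixes n :: nat and p :: "nat \<Rightarrow> real"
  assumes n: "n \<ge> 2"
    and sum0: "(\<Sum>m\<le>n-1. real ((n-1) choose m) * real (n choose (n-1-m)) * ((real m - real (n-1)) * p m)) = 0"
  shows "(\<Sum>m\<le>n-2. real ((n-1) choose m) * real ((n-1) choose Suc m) * p m) = 0"
proof -
  have "(\<Sum>m\<le>n-1. real ((n-1) choose m) * real (n choose (n-1-m)) * ((real m - real (n-1)) * p m)) =
     (\<Sum>m\<le>n-1. - real n * (real ((n-1) choose m) * real ((n-1) choose Suc m) * p m))"
  proof (intro sum.cong refl)
    fix m assume m: "m \<in> {..n-1}"
    have "n choose (n-1-m) = n choose (Suc m)"
      using m n by (subst binomial_symmetric) (auto simp: Suc_diff_Suc)
    moreover have "(n - Suc m) * (n choose Suc m) = n * ((n-1) choose Suc m)"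
      by (rule binomial_absorb_comp)
    then have "real (n - Suc m) * real (n choose Suc m) = real n * real ((n-1) choose Suc m)"
      by (metis of_nat_mult)
    moreover have "real m - real (n-1) = - real (n - Suc m)" using m n by (simp add: of_nat_diff)
    ultimately show "real ((n-1) choose m) * real (n choose (n-1-m)) * ((real m - real (n-1)) * p m) =
        - real n * (real ((n-1) choose m) * real ((n-1) choose Suc m) * p m)"
      by (simp add: mult_ac)
  qed
  also have "\<dots> = - real n * (\<Sum>m\<le>n-1. real ((n-1) choose m) * real ((n-1) choose Suc m) * p m)"
    by (rule sum_distrib_left[symmetric])
  also have "(\<Sum>m\<le>n-1. real ((n-1) choose m) * real ((n-1) choose Suc m) * p m) =
      (\<Sum>m\<le>n-2. real ((n-1) choose m) * real ((n-1) choose Suc m) * p m)"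
  proof (rule sum.mono_neutral_right)
    show "\<forall>i\<in>{..n-1} - {..n-2}. real ((n-1) choose i) * real ((n-1) choose Suc i) * p i = 0"
      using n by (auto simp: binomial_eq_0)
  qed auto
  finally show ?thesis using sum0 n by simp
qed

section \<open>Folding symmetric codes\<close>

lemma degree_set_bounds:
  assumes C: "symmetric_inner_distribution_code n C" and d: "d \<in> degree_set n C"
  shows "1 \<le> d" "d \<le> n - 1" "n - d \<in> degree_set n C"
proof -
  have pos: "1 \<le> e" if "e \<in> degree_set n C" for e
  proof -
    obtain x y where xy: "x \<in> C" "y \<in> C" "x \<noteq> y" "e = n - card (x \<inter> y)"
      using \<open>e \<in> degree_set n C\<close> by (auto simp: degree_set_def johnson_dist_def)
    have x: "finite x" "card x = n" and y: "finite y" "card y = n"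
      using C xy by (auto simp: symmetric_inner_distribution_code_def johnson_points_def intro: finite_subset)
    have "card (x \<inter> y) \<noteq> n"
    proof
      assume "card (x \<inter> y) = n"
      then have "x \<inter> y = x" using card_subset_eq[OF x(1), of "x \<inter> y"] x by simp
      then have "x \<subseteq> y" by blast
      then have "x = y" using card_subset_eq[OF y(1)] x y by simp
      then show False using \<open>x \<noteq> y\<close> by auto
    qed
    moreover have "card (x \<inter> y) \<le> n" using x card_mono[of x "x \<inter> y"] by auto
    ultimately show ?thesis using xy by simp
  qed
  show "n - d \<in> degree_set n C" using C d by (auto simp: symmetric_inner_distribution_code_def)
  from pos[OF this] pos[OF d] show "1 \<le> d" "d \<le> n - 1" by auto
qed

text \<open>Complementing one of two words replaces their distance d by n-d, so the symmetry of the degree set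
makes folding harmless; as distance n does not occur, no two codewords are identified.\<close>

lemma code_folding:
  assumes n: "n \<ge> 1" and C: "symmetric_inner_distribution_code n C"
  obtains C' where "C' \<subseteq> slice {1..2*n-1} (n-1)" "card C' = card C"
    "\<And>a b. a \<in> C' \<Longrightarrow> b \<in> C' \<Longrightarrow> a \<noteq> b \<Longrightarrow> card (a \<inter> b) \<in> (\<lambda>d. n - 1 - d) ` degree_set n C"
proof -
  define V where "V = {1..2*n-1}"
  define f where "f x = (if 2*n \<in> x then x - {2*n} else V - x)" for x
  have V: "finite V" "card V = 2*n-1" "2*n \<notin> V" using n by (auto simp: V_def)
  have VV: "{1..2*n} = insert (2*n) V" using n by (auto simp: V_def)
  have C_props: "finite x" "x \<subseteq> insert (2*n) V" "card x = n" if "x \<in> C" for x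
    using C that by (auto simp: symmetric_inner_distribution_code_def johnson_points_def VV[symmetric] intro: finite_subset)
  have distD: "n - card (x \<inter> y) \<in> degree_set n C" if "x \<in> C" "y \<in> C" "x \<noteq> y" for x y
    using that by (auto simp: degree_set_def johnson_dist_def)
  have mixed: "card (f x \<inter> f y) \<in> (\<lambda>d. n - 1 - d) ` degree_set n C \<and> f x \<noteq> f y"
    if xy: "x \<in> C" "y \<in> C" "2*n \<in> x" "2*n \<notin> y" for x y
  proof -
    have ne: "x \<noteq> y" using xy by auto
    have "f x \<inter> f y = x - y - {2*n}" using xy C_props[of x] by (auto simp: f_def)
    moreover have "2*n \<in> x - y" using xy by simp
    ultimately have "card (f x \<inter> f y) = n - card (x \<inter> y) - 1"
      using C_props[of x] xy by (simp add: card_Diff_singleton card_Diff_subset_Int)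
    moreover have "n - card (x \<inter> y) - 1 = n - 1 - (n - (n - card (x \<inter> y)))"
      using degree_set_bounds(1,2)[OF C distD[OF xy(1,2) ne]] by simp
    moreover have "n - (n - card (x \<inter> y)) \<in> degree_set n C"
      by (rule degree_set_bounds(3)[OF C distD[OF xy(1,2) ne]])
    ultimately have "card (f x \<inter> f y) \<in> (\<lambda>d. n - 1 - d) ` degree_set n C" by (metis imageI)
    moreover have "f x \<noteq> f y"
    proof
      assume "f x = f y"
      then have "x - {2*n} = V - y" using xy by (simp add: f_def)
      then have "x \<inter> y = {}" using xy by auto
      then show False
        using degree_set_bounds(2)[OF C distD[OF xy(1,2) ne]] n by simp
    qed
    ultimately show ?thesis by blast
  qed
  have same: "card (f x \<inter> f y) \<in> (\<lambda>d. n - 1 - d) ` degree_set n C \<and> f x \<noteq> f y"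
    if xy: "x \<in> C" "y \<in> C" "x \<noteq> y" "2*n \<in> x \<longleftrightarrow> 2*n \<in> y" for x y
  proof (cases "2*n \<in> x")
    case True
    then have "f x \<inter> f y = x \<inter> y - {2*n}" "2*n \<in> x \<inter> y" "f x \<noteq> f y" using xy by (auto simp: f_def)
    moreover from this have "card (f x \<inter> f y) = n - 1 - (n - card (x \<inter> y))"
      using C_props[OF xy(1)] card_mono[of x "x \<inter> y"] by (simp add: card_Diff_singleton)
    ultimately show ?thesis using imageI[OF distD[OF xy(1-3)], of "\<lambda>d. n - 1 - d"] by simp
  next
    case False
    then have sub: "x \<subseteq> V" "y \<subseteq> V" using xy C_props by auto
    have "f x \<inter> f y = V - (x \<union> y)" "f x \<noteq> f y" using False xy sub by (auto simp: f_def)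
    moreover have "card (V - (x \<union> y)) = 2*n-1 - card (x \<union> y)"
      using sub V by (subst card_Diff_subset) (auto intro: finite_subset)
    moreover have "card (x \<union> y) + card (x \<inter> y) = 2*n"
      using card_Un_Int[of x y] C_props xy by simp
    moreover have "card (x \<inter> y) \<le> n" using C_props[OF xy(1)] card_mono[of x "x \<inter> y"] by auto
    ultimately have "card (f x \<inter> f y) = n - 1 - (n - card (x \<inter> y))" by simp
    then show ?thesis using imageI[OF distD[OF xy(1-3)], of "\<lambda>d. n - 1 - d"] \<open>f x \<noteq> f y\<close> by simp
  qed
  have dist: "card (f x \<inter> f y) \<in> (\<lambda>d. n - 1 - d) ` degree_set n C \<and> f x \<noteq> f y"
    if "x \<in> C" "y \<in> C" "x \<noteq> y" for x y
    using same[OF that] mixed[OF that(1,2)] mixed[OF that(2,1)] by (cases "2*n \<in> x"; cases "2*n \<in> y") (auto simp: Int_commute)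
  show thesis
  proof (rule that[of "f ` C"])
    show "f ` C \<subseteq> slice {1..2*n-1} (n-1)"
    proof (clarify)
      fix x assume x: "x \<in> C"
      have "f x \<subseteq> V" using C_props[OF x] by (auto simp: f_def)
      moreover have "card (f x) = n - 1"
      proof (cases "2*n \<in> x")
        case True
        then show ?thesis using C_props[OF x] by (simp add: f_def card_Diff_singleton)
      next
        case False
        then have "x \<subseteq> V" using C_props[OF x] by auto
        then show ?thesis using False C_props[OF x] V by (simp add: f_def card_Diff_subset)
      qed
      ultimately show "f x \<in> slice {1..2*n-1} (n-1)" by (simp add: slice_def V_def)
    qed
    show "card (f ` C) = card C" using dist by (intro card_image inj_onI) blast
    show "card (a \<inter> b) \<in> (\<lambda>d. n - 1 - d) ` degree_set n C"
      if "a \<in> f ` C" "b \<in> f ` C" "a \<noteq> b" for a b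
      using that dist by blast
  qed
qed

lemma tight_code_intersection_polynomial:
  assumes n: "n \<ge> 1" and s: "s \<ge> 1" and C: "tight_symmetric_inner_distribution_code n s C"
  obtains R where "finite R" "card R = s" "R \<subseteq> {..n-2}" "n \<ge> 2" "s \<le> n - 1"
    "\<And>r. r \<in> R \<Longrightarrow> n - 2 - r \<in> R"
    "\<And>i. i < s \<Longrightarrow> (\<Sum>x\<le>n-2. real ((n-1) choose x) * real ((n-1) choose Suc x) *
        ((\<Prod>l<i. real x - real l) * (\<Prod>r\<in>R. real x - real r))) = 0"
proof -
  define D where "D = degree_set n C"
  have sym: "symmetric_inner_distribution_code n C" and cD: "card D = s" and cC: "card C = (2*n-1) choose s"
    using C by (auto simp: tight_symmetric_inner_distribution_code_def code_degree_def D_def)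
  have D: "D \<subseteq> {1..n-1}" using degree_set_bounds[OF sym] by (auto simp: D_def)
  have sn: "s \<le> n - 1" using card_mono[OF _ D] cD by simp
  define R where "R = (\<lambda>d. n - 1 - d) ` D"
  have inj: "inj_on (\<lambda>d. n - 1 - d) D"
  proof (rule inj_onI)
    fix d e assume "d \<in> D" "e \<in> D" and eq: "n - 1 - d = n - 1 - e"
    then have "d \<le> n - 1" "e \<le> n - 1" using D by auto
    then show "d = e" using eq by linarith
  qed
  have R: "finite R" "card R = s"
    using D finite_subset[OF D] card_image[OF inj] cD by (auto simp: R_def)
  have R_sub: "R \<subseteq> {..n-2}"
  proof
    fix r assume "r \<in> R"
    then obtain d where "d \<in> D" "r = n - 1 - d" by (auto simp: R_def)
    moreover from this have "1 \<le> d" using D by auto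
    ultimately show "r \<in> {..n-2}" by simp
  qed
  obtain C' where C': "C' \<subseteq> slice {1..2*n-1} (n-1)" "card C' = card C"
    "\<And>a b. a \<in> C' \<Longrightarrow> b \<in> C' \<Longrightarrow> a \<noteq> b \<Longrightarrow> card (a \<inter> b) \<in> R"
    using code_folding[OF n sym] unfolding R_def D_def by metis
  show thesis
  proof (rule that[OF R R_sub _ sn])
    show "n \<ge> 2" using sn s by simp
    show "n - 2 - r \<in> R" if r: "r \<in> R" for r
    proof -
      obtain d where d: "d \<in> D" "r = n - 1 - d" using r by (auto simp: R_def)
      then have "n - d \<in> D" "1 \<le> d" "d \<le> n - 1" using degree_set_bounds[OF sym] by (auto simp: D_def)
      then show ?thesis using d by (auto simp: R_def intro!: image_eqI[of _ _ "n - d"])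
    qed
    fix i assume i: "i < s"
    have "(\<Sum>m\<le>n-1. real ((n-1) choose m) * real ((card {1..2*n-1} - (n-1)) choose (n-1-m)) *
       ((real m - real (n-1)) * (\<Prod>l<i. real m - real l) * (\<Prod>r\<in>R. real m - real r))) = 0"
    proof (rule tight_code_orthogonality[OF _ _ R(1) _ _ C'(1)])
      show "n - 1 \<notin> R" using R_sub sn s by auto
      show "card C' = card {1..2*n-1} choose card R" using C'(2) cC R by simp
    qed (use C' R sn i in auto)
    moreover have "card {1..2*n-1} - (n-1) = n" using n by simp
    ultimately show "(\<Sum>x\<le>n-2. real ((n-1) choose x) * real ((n-1) choose Suc x) *
        ((\<Prod>l<i. real x - real l) * (\<Prod>r\<in>R. real x - real r))) = 0"
      using sn s by (intro hahn_weight_orthogonality) (simp_all add: mult.assoc)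
  qed
qed

section \<open>The Hahn difference equation\<close>

definition falling :: "nat \<Rightarrow> real \<Rightarrow> real" where
  "falling j x = (\<Prod>l<j. x - real l)"

lemma falling_0 [simp]: "falling 0 x = 1"
  and falling_Suc: "falling (Suc j) x = falling j x * (x - real j)"
  by (simp_all add: falling_def)

lemma falling_shift: "falling (Suc j) (x + 1) = (x + 1) * falling j x"
  unfolding falling_def prod.lessThan_Suc_shift by simp

lemma falling_nat_eq_0: "x < j \<Longrightarrow> falling j (real x) = 0"
  unfolding falling_def by (rule prod_zero) auto

lemma falling_nat_neq_0: "falling j (real j) \<noteq> 0"
  by (simp add: falling_def)

text \<open>The falling factorials are monic with integer coefficients, so a monic polynomial with integer zeros
has integer coefficients in this basis. Its explicit coefficients are the source of all
divisibility conditions.\<close>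

lemma integer_roots_falling_expansion:
  assumes "finite R"
  obtains a :: "nat \<Rightarrow> int" where "a (card R) = 1"
    "\<And>x. (\<Prod>r\<in>R. x - real r) = (\<Sum>j\<le>card R. of_int (a j) * falling j x)"
proof -
  have "\<exists>a :: nat \<Rightarrow> int. a (card R) = 1 \<and> (\<forall>j>card R. a j = 0) \<and>
     (\<forall>x. (\<Prod>r\<in>R. x - real r) = (\<Sum>j\<le>card R. of_int (a j) * falling j x))"
    using assms
  proof (induction R rule: finite_induct)
    case empty
    show ?case by (intro exI[of _ "\<lambda>j. if j = 0 then 1 else 0"]) auto
  next
    case (insert r R)
    define m where "m = card R"
    obtain a :: "nat \<Rightarrow> int" where a: "a m = 1" "\<And>j. j > m \<Longrightarrow> a j = 0"
      "\<And>x. (\<Prod>r\<in>R. x - real r) = (\<Sum>j\<le>m. of_int (a j) * falling j x)"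
      using insert.IH unfolding m_def by blast
    define b where "b j = (if j = 0 then 0 else a (j - 1)) + (int j - int r) * a j" for j
    have "(\<Prod>r\<in>insert r R. x - real r) = (\<Sum>j\<le>Suc m. of_int (b j) * falling j x)" for x
    proof -
      have "(\<Prod>r\<in>insert r R. x - real r) = (\<Sum>j\<le>m. of_int (a j) * ((x - real r) * falling j x))"
        using insert by (simp add: a(3) sum_distrib_left mult_ac)
      also have "\<dots> = (\<Sum>j\<le>m. of_int (a j) * falling (Suc j) x + (real j - real r) * of_int (a j) * falling j x)"
        by (intro sum.cong refl) (simp add: falling_Suc algebra_simps)
      also have "\<dots> = (\<Sum>j\<le>m. of_int (a j) * falling (Suc j) x) + (\<Sum>j\<le>Suc m. (real j - real r) * of_int (a j) * falling j x)"
        by (simp add: sum.distrib a(2))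
      also have "(\<Sum>j\<le>m. of_int (a j) * falling (Suc j) x) =
          (\<Sum>j\<le>Suc m. of_int (if j = 0 then 0 else a (j - 1)) * falling j x)"
        by (simp add: sum.atMost_Suc_shift del: sum.atMost_Suc)
      also have "\<dots> + (\<Sum>j\<le>Suc m. (real j - real r) * of_int (a j) * falling j x) =
          (\<Sum>j\<le>Suc m. of_int (b j) * falling j x)"
        unfolding sum.distrib[symmetric] by (intro sum.cong refl) (auto simp: b_def algebra_simps)
      finally show ?thesis .
    qed
    moreover have "b (Suc m) = 1" "\<forall>j>Suc m. b j = 0" by (auto simp: b_def a)
    ultimately show ?case using insert unfolding m_def by (intro exI[of _ b]) simp
  qed
  then show thesis using that by blast
qed

text \<open>The difference operator whose polynomial eigenfunctions are the Hahn polynomials for the weight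
\<open>hahn_weight\<close>.\<close>

definition hahn_op :: "real \<Rightarrow> (real \<Rightarrow> real) \<Rightarrow> real \<Rightarrow> real" where
  "hahn_op n f x = (n-1-x) * (n-2-x) * (f (x+1) - f x) + x * (x+1) * (f (x-1) - f x)"

definition hahn_weight :: "nat \<Rightarrow> nat \<Rightarrow> real" where
  "hahn_weight n x = real ((n-1) choose x) * real ((n-1) choose Suc x)"

text \<open>The operator is bidiagonal on falling factorials, which makes the coefficients of an eigenfunction a
one-term recursion.\<close>

lemma hahn_op_falling:
  "hahn_op n (falling j) x =
     - real j * (2*n - 1 - real j) * falling j x + real j * (n - real j) * (n - real j - 1) * falling (j-1) x"
proof (cases j)
  case 0
  then show ?thesis by (simp add: hahn_op_def)
next
  case (Suc i)
  define q where "q = falling i x"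
  have f0: "falling (Suc i) x = q * (x - real i)" by (simp add: falling_Suc q_def)
  have f1: "falling (Suc i) (x+1) = (x+1) * q" by (simp add: falling_shift q_def)
  have f2: "x * falling (Suc i) (x-1) = q * (x - real i) * (x - real i - 1)"
    using falling_shift[of "Suc i" "x-1"] by (simp add: falling_Suc q_def algebra_simps)
  have "hahn_op n (falling (Suc i)) x =
    (n-1-x) * (n-2-x) * ((x+1) * q - q * (x - real i)) +
    (x+1) * (x * falling (Suc i) (x-1) - x * (q * (x - real i)))"
    unfolding hahn_op_def f0 f1 by (simp add: algebra_simps)
  then show ?thesis unfolding Suc f2 f0 by (simp add: q_def[symmetric] algebra_simps)
qed

lemma hahn_op_sum:
  "hahn_op n (\<lambda>x. \<Sum>j\<in>J. c j * f j x) x = (\<Sum>j\<in>J. c j * hahn_op n (f j) x)"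
  by (simp add: hahn_op_def sum_distrib_left sum_subtractf[symmetric] sum.distrib[symmetric] algebra_simps)

text \<open>Detailed balance between x and x+1, the reason for self-adjointness.\<close>

lemma hahn_weight_balance:
  assumes "n \<ge> 1"
  shows "hahn_weight n x * ((real n - 1 - real x) * (real n - 2 - real x)) =
         hahn_weight n (Suc x) * (real (Suc x) * (real (Suc x) + 1))"
proof -
  have step: "(real n - 1 - real k) * real ((n-1) choose k) = real (Suc k) * real ((n-1) choose Suc k)" for k
  proof (cases "k \<le> n - 1")
    case True
    have "Suc k * ((n-1) choose Suc k) = (n - 1 - k) * ((n-1) choose k)"
      by (simp only: binomial_absorption binomial_absorb_comp)
    then have "real (Suc k) * real ((n-1) choose Suc k) = real (n - 1 - k) * real ((n-1) choose k)"
      by (simp only: of_nat_mult[symmetric])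
    then show ?thesis using True assms by (simp add: of_nat_diff)
  qed (simp add: binomial_eq_0)
  have "hahn_weight n x * ((real n - 1 - real x) * (real n - 2 - real x)) =
     ((real n - 1 - real x) * real ((n-1) choose x)) * ((real n - 1 - real (Suc x)) * real ((n-1) choose Suc x))"
    by (simp add: hahn_weight_def algebra_simps)
  then show ?thesis unfolding step by (simp add: hahn_weight_def algebra_simps)
qed

lemma hahn_op_self_adjoint:
  fixes n :: nat
  assumes n: "n \<ge> 2"
  shows "(\<Sum>x\<le>n-2. hahn_weight n x * (hahn_op n f x * g x)) =
         (\<Sum>x\<le>n-2. hahn_weight n x * (f x * hahn_op n g x))"
proof -
  define B where "B x = (real n - 1 - x) * (real n - 2 - x)" for x :: real
  define D where "D x = x * (x + 1)" for x :: real
  define m where "m = n - 2"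
  have half: "(\<Sum>x\<le>m. hahn_weight n x * (B x * f (real x + 1) * g x)) =
        (\<Sum>x\<le>m. hahn_weight n x * (D x * f x * g (real x - 1)))" for f g :: "real \<Rightarrow> real"
  proof -
    have "(\<Sum>x\<le>m. hahn_weight n x * (B x * f (real x + 1) * g x)) =
          (\<Sum>x<m. hahn_weight n x * (B x * f (real x + 1) * g x))"
      using n by (simp add: lessThan_Suc_atMost[symmetric] B_def m_def of_nat_diff)
    also have "\<dots> = (\<Sum>x<m. hahn_weight n (Suc x) * (D (Suc x) * f (Suc x) * g (real (Suc x) - 1)))"
    proof (rule sum.cong[OF refl])
      fix x
      have "hahn_weight n x * B x = hahn_weight n (Suc x) * D (Suc x)"
        unfolding B_def D_def using n by (intro hahn_weight_balance) simp
      moreover have "real (Suc x) = real x + 1" "real (Suc x) - 1 = real x" by simp_all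
      ultimately show "hahn_weight n x * (B x * f (real x + 1) * g x) =
          hahn_weight n (Suc x) * (D (Suc x) * f (Suc x) * g (real (Suc x) - 1))"
        by (simp only: mult.assoc[symmetric])
    qed
    also have "\<dots> = (\<Sum>x<Suc m. hahn_weight n x * (D x * f x * g (real x - 1)))"
      unfolding sum.lessThan_Suc_shift by (simp add: D_def)
    finally show ?thesis by (simp add: lessThan_Suc_atMost)
  qed
  have op: "hahn_op n f x = B x * f (x+1) + D x * f (x-1) - (B x + D x) * f x" for f x
    by (simp add: hahn_op_def B_def D_def algebra_simps)
  have "(\<Sum>x\<le>m. hahn_weight n x * (hahn_op n f x * g x)) =
     (\<Sum>x\<le>m. hahn_weight n x * (B x * f (real x + 1) * g x)) + (\<Sum>x\<le>m. hahn_weight n x * (D x * f (real x - 1) * g x))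
      - (\<Sum>x\<le>m. hahn_weight n x * ((B x + D x) * f x * g x))"
    unfolding op sum.distrib[symmetric] sum_subtractf[symmetric]
    by (intro sum.cong refl) (simp add: algebra_simps)
  also have "(\<Sum>x\<le>m. hahn_weight n x * (D x * f (real x - 1) * g x)) = (\<Sum>x\<le>m. hahn_weight n x * (B x * f x * g (real x + 1)))"
    using half[of g f] by (simp add: mult_ac)
  also have "(\<Sum>x\<le>m. hahn_weight n x * (B x * f (real x + 1) * g x)) + \<dots> -
        (\<Sum>x\<le>m. hahn_weight n x * ((B x + D x) * f x * g x)) =
     (\<Sum>x\<le>m. hahn_weight n x * (f x * hahn_op n g x))"
    unfolding half op sum.distrib[symmetric] sum_subtractf[symmetric]
    by (intro sum.cong refl) (simp add: algebra_simps)
  finally show ?thesis by (simp add: m_def)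
qed

lemma falling_linear_independent:
  assumes zero: "\<And>x. x < k \<Longrightarrow> (\<Sum>j<k. c j * falling j (real x)) = 0" and j: "j < k"
  shows "c j = 0"
  using j
proof (induction j rule: less_induct)
  case (less j)
  have "(\<Sum>i<k. c i * falling i (real j)) = (\<Sum>i\<in>{j}. c i * falling i (real j))"
  proof (rule sum.mono_neutral_right)
    show "\<forall>i\<in>{..<k} - {j}. c i * falling i (real j) = 0"
      using less by (auto simp: falling_nat_eq_0 neq_iff)
  qed (use less in auto)
  then show ?case using zero[of j] less falling_nat_neq_0[of j] by simp
qed

text \<open>Subtracting the eigenvalue of degree s leaves a polynomial q of degree below s. By
self-adjointness q is again orthogonal to all polynomials of degree below s, in particular to
itself, so it vanishes on 0,...,n-2; as s \<le> n-1 its coefficients vanish as well.\<close>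

lemma orthogonal_polynomial_eigenfunction:
  fixes n s :: nat and a :: "nat \<Rightarrow> real"
  assumes n: "n \<ge> 2" and s: "s \<le> n - 1"
    and p: "\<And>x. p x = (\<Sum>j\<le>s. a j * falling j x)"
    and orth: "\<And>i. i < s \<Longrightarrow> (\<Sum>x\<le>n-2. hahn_weight n x * (p x * falling i x)) = 0"
  shows "\<And>x. x \<le> n - 2 \<Longrightarrow> hahn_op n p (real x) = - real s * (2 * real n - 1 - real s) * p x"
    and "\<And>j. j < s \<Longrightarrow>
      (real j * (2 * real n - 1 - real j) - real s * (2 * real n - 1 - real s)) * a j =
      a (Suc j) * (real (Suc j) * (real n - real (Suc j)) * (real n - real (Suc j) - 1))"
proof -
  define e where "e j = real j * (2 * real n - 1 - real j)" for j
  define c where "c j = real j * (real n - real j) * (real n - real j - 1)" for j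
  define d where "d j = a j * (e s - e j) + a (Suc j) * c (Suc j)" for j
  define q where "q x = hahn_op n p x + e s * p x" for x
  have op: "hahn_op n (falling j) x = - e j * falling j x + c j * falling (j-1) x" for j x
    unfolding hahn_op_falling e_def c_def by simp
  have q: "q x = (\<Sum>j<s. d j * falling j x)" for x
  proof -
    have "q x = (\<Sum>j\<le>s. a j * hahn_op n (falling j) x) + e s * (\<Sum>j\<le>s. a j * falling j x)"
      unfolding q_def p hahn_op_sum ..
    also have "\<dots> = (\<Sum>j\<le>s. a j * (e s - e j) * falling j x) + (\<Sum>j\<le>s. a j * c j * falling (j-1) x)"
      unfolding sum_distrib_left sum.distrib[symmetric] op by (intro sum.cong refl) (simp add: algebra_simps)
    also have "(\<Sum>j\<le>s. a j * (e s - e j) * falling j x) = (\<Sum>j<s. a j * (e s - e j) * falling j x)"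
      by (simp add: lessThan_Suc_atMost[symmetric])
    also have "(\<Sum>j\<le>s. a j * c j * falling (j-1) x) = (\<Sum>j<s. a (Suc j) * c (Suc j) * falling j x)"
      unfolding lessThan_Suc_atMost[symmetric] sum.lessThan_Suc_shift by (simp add: c_def)
    finally show ?thesis unfolding sum.distrib[symmetric] d_def by (simp add: distrib_right)
  qed
  have q_orth: "(\<Sum>x\<le>n-2. hahn_weight n x * (q x * falling i x)) = 0" if i: "i < s" for i
  proof -
    have "(\<Sum>x\<le>n-2. hahn_weight n x * (q x * falling i x)) =
       (\<Sum>x\<le>n-2. hahn_weight n x * (hahn_op n p x * falling i x)) + e s * (\<Sum>x\<le>n-2. hahn_weight n x * (p x * falling i x))"
      unfolding q_def sum_distrib_left sum.distrib[symmetric] by (intro sum.cong refl) (simp add: algebra_simps)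
    also have "\<dots> = (\<Sum>x\<le>n-2. hahn_weight n x * (p x * hahn_op n (falling i) x))"
      using orth[OF i] by (simp add: hahn_op_self_adjoint[OF n])
    also have "\<dots> = - e i * (\<Sum>x\<le>n-2. hahn_weight n x * (p x * falling i x)) +
        c i * (\<Sum>x\<le>n-2. hahn_weight n x * (p x * falling (i-1) x))"
      unfolding op sum_distrib_left sum.distrib[symmetric] by (intro sum.cong refl) (simp add: algebra_simps)
    also have "\<dots> = 0" using orth[OF i] orth[of "i-1"] i by simp
    finally show ?thesis .
  qed
  have "(\<Sum>x\<le>n-2. hahn_weight n x * (q x)\<^sup>2) = (\<Sum>x\<le>n-2. \<Sum>j<s. d j * (hahn_weight n x * (q x * falling j x)))"
  proof (rule sum.cong[OF refl])
    fix x
    have "hahn_weight n x * (q x)\<^sup>2 = hahn_weight n x * q x * (\<Sum>j<s. d j * falling j x)"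
      unfolding q[symmetric] by (simp add: power2_eq_square)
    then show "hahn_weight n x * (q x)\<^sup>2 = (\<Sum>j<s. d j * (hahn_weight n x * (q x * falling j x)))"
      by (simp add: sum_distrib_left mult_ac)
  qed
  also have "\<dots> = (\<Sum>j<s. d j * (\<Sum>x\<le>n-2. hahn_weight n x * (q x * falling j x)))"
    unfolding sum_distrib_left by (rule sum.swap)
  also have "\<dots> = 0" by (simp add: q_orth)
  finally have sum0: "(\<Sum>x\<le>n-2. hahn_weight n x * (q x)\<^sup>2) = 0" .
  have W: "hahn_weight n x > 0" if "x \<le> n - 2" for x
    using that n by (simp add: hahn_weight_def)
  \<comment> \<open>a sum of nonnegative terms with positive weights\<close>
  have q0: "q (real x) = 0" if x: "x \<le> n - 2" for x
  proof -
    have "hahn_weight n x * (q x)\<^sup>2 = 0"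
      using sum_nonneg_0[OF finite_atMost _ sum0, of x] W x by (simp add: less_imp_le)
    then show ?thesis using W[OF x] by simp
  qed
  show "hahn_op n p (real x) = - real s * (2 * real n - 1 - real s) * p x" if "x \<le> n - 2" for x
    using q0[OF that] by (simp add: q_def e_def)
  fix j assume j: "j < s"
  have "d j = 0"
  proof (rule falling_linear_independent[OF _ j])
    fix x assume "x < s"
    then show "(\<Sum>j<s. d j * falling j (real x)) = 0" using q0[of x] s q[of "real x"] by simp
  qed
  then show "(real j * (2 * real n - 1 - real j) - real s * (2 * real n - 1 - real s)) * a j =
      a (Suc j) * (real (Suc j) * (real n - real (Suc j)) * (real n - real (Suc j) - 1))"
    unfolding d_def e_def c_def by (simp add: algebra_simps)
qed

section \<open>Oscillation of polynomials with integer zeros\<close>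

text \<open>The set R of integer zeros of a polynomial P that satisfies the three-term recurrence on
0,...,n-2. The coefficients B, D, Q are those of \<open>hahn_op\<close> together with the eigenvalue, and
E(x)=D(x)B(x-1) is the product that governs the ratio of neighbouring values.\<close>

locale integral_hahn_roots =
  fixes n s :: int and R :: "int set" and P B D Q E :: "int \<Rightarrow> real"
  defines "P \<equiv> \<lambda>x. \<Prod>r\<in>R. of_int (x - r)"
    and "B \<equiv> \<lambda>x. of_int ((n-1-x) * (n-2-x))"
    and "D \<equiv> \<lambda>x. of_int (x * (x+1))"
    and "Q \<equiv> \<lambda>x. of_int ((n-1-x) * (n-2-x) + x * (x+1) - s * (2*n-1-s))"
    and "E \<equiv> \<lambda>x. of_int (x * (x+1) * ((n-x) * (n-1-x)))"
  assumes fin: "finite R" and card: "int (card R) = s" and sn: "s + 2 \<le> n"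
    and range: "R \<subseteq> {0..n-2}" and reflect: "\<And>r. r \<in> R \<Longrightarrow> n - 2 - r \<in> R"
    and recurrence: "\<And>x. 0 \<le> x \<Longrightarrow> x \<le> n - 2 \<Longrightarrow> B x * P (x+1) + D x * P (x-1) = Q x * P x"
begin

lemma P_eq_0_iff: "P x = 0 \<longleftrightarrow> x \<in> R"
  using fin by (auto simp: P_def)

text \<open>No zero lies strictly between x and x+1, as all zeros are integers.\<close>

lemma P_same_sign: "0 \<le> P x * P (x+1)"
proof -
  have "P x * P (x+1) = (\<Prod>r\<in>R. of_int ((x - r) * (x + 1 - r)))"
    by (simp add: P_def prod.distrib)
  also have "\<dots> \<ge> 0"
  proof (intro prod_nonneg ballI)
    fix r
    have "0 \<le> (x - r) * (x + 1 - r)"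
      by (cases "r \<le> x") (auto intro: mult_nonneg_nonneg mult_nonpos_nonpos)
    then show "(0::real) \<le> of_int ((x - r) * (x + 1 - r))" by (simp only: of_int_0_le_iff)
  qed
  finally show ?thesis .
qed

lemma B_pos: "0 \<le> x \<Longrightarrow> x \<le> n - 3 \<Longrightarrow> 0 < B x"
  and D_pos: "1 \<le> x \<Longrightarrow> 0 < D x"
  by (simp_all add: B_def D_def)

lemma B_nonneg: "x \<le> n - 2 \<Longrightarrow> 0 \<le> B x"
  by (simp add: B_def)

text \<open>Two neighbouring zeros would propagate through the recurrence to all of 0,...,n-2, which has more
than s elements.\<close>

lemma not_adjacent:
  assumes x: "x \<in> R" shows "x + 1 \<notin> R"
proof
  assume x1: "x + 1 \<in> R"
  have down: "x - int k \<in> R \<and> x + 1 - int k \<in> R" if "int k \<le> x" for k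
    using that
  proof (induction k)
    case 0 then show ?case using x x1 by simp
  next
    case (Suc k)
    define y where "y = x - int k"
    have y: "y \<in> R" "y + 1 \<in> R" "1 \<le> y" using Suc by (auto simp: y_def algebra_simps)
    moreover have "y \<le> n - 2" using y(1) range by auto
    ultimately have "D y * P (y-1) = 0"
      using recurrence[of y] by (simp add: P_eq_0_iff[THEN iffD2])
    then have "y - 1 \<in> R" using D_pos[OF y(3)] by (simp flip: P_eq_0_iff)
    then show ?case using y by (simp add: y_def algebra_simps)
  qed
  have up: "x + int k \<in> R \<and> x + 1 + int k \<in> R" if "x + 1 + int k \<le> n - 2" for k
    using that
  proof (induction k)
    case 0 then show ?case using x x1 by simp
  next
    case (Suc k)
    define y where "y = x + 1 + int k"
    have y: "y \<in> R" "y - 1 \<in> R" "0 \<le> y" "y \<le> n - 3" using Suc range by (auto simp: y_def algebra_simps)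
    then have "B y * P (y+1) = 0"
      using recurrence[of y] by (simp add: P_eq_0_iff[THEN iffD2])
    then have "y + 1 \<in> R" using B_pos[OF y(3,4)] by (simp flip: P_eq_0_iff)
    then show ?case using y by (simp add: y_def algebra_simps)
  qed
  have "{0..n-2} \<subseteq> R"
  proof
    fix z assume z: "z \<in> {0..n-2}"
    show "z \<in> R"
    proof (cases "z \<le> x")
      case True then show ?thesis using down[of "nat (x - z)"] z by simp
    next
      case False then show ?thesis using up[of "nat (z - x - 1)"] z by simp
    qed
  qed
  then have "card {0..n-2} \<le> card R" by (intro card_mono fin)
  then show False using card sn by simp
qed

text \<open>The ratio of neighbouring values, scaled so that the recurrence becomes the continued fraction step
\<open>tau_step\<close>. It starts at Q after a zero, and stays positive until it reaches 0 exactly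
one step before the next zero.\<close>

definition tau :: "int \<Rightarrow> real" where "tau x = B x * P (x+1) / P x"

lemma tau_nonneg:
  assumes "x \<le> n - 2" shows "0 \<le> tau x"
proof -
  have "0 \<le> P (x+1) / P x"
    using P_same_sign[of x] by (auto simp: zero_le_divide_iff zero_le_mult_iff)
  from mult_nonneg_nonneg[OF B_nonneg[OF assms] this] show ?thesis by (simp add: tau_def)
qed

lemma tau_pos: "0 \<le> x \<Longrightarrow> x \<le> n - 3 \<Longrightarrow> x \<notin> R \<Longrightarrow> x + 1 \<notin> R \<Longrightarrow> 0 < tau x"
  using tau_nonneg[of x] B_pos[of x] by (simp add: tau_def less_le P_eq_0_iff)

lemma tau_before_root: "x + 1 \<in> R \<Longrightarrow> tau x = 0"
  by (simp add: tau_def P_eq_0_iff[THEN iffD2])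

lemma tau_after_root:
  assumes "a \<in> R" "a + 1 \<le> n - 2" shows "tau (a+1) = Q (a+1)"
proof -
  have "P a = 0" "P (a+1) \<noteq> 0" using assms not_adjacent[of a] by (simp_all add: P_eq_0_iff)
  moreover have "B (a+1) * P (a+1+1) + D (a+1) * P (a+1-1) = Q (a+1) * P (a+1)"
    using assms range by (intro recurrence) auto
  ultimately have eq: "B (a+1) * P (a+1+1) = Q (a+1) * P (a+1)" by simp
  show ?thesis unfolding tau_def eq using \<open>P (a+1) \<noteq> 0\<close> by simp
qed

lemma tau_step:
  assumes x: "1 \<le> x" "x \<le> n - 2" and nz: "x \<notin> R" "x - 1 \<notin> R"
  shows "tau x = Q x - E x / tau (x-1)"
proof -
  have P: "P x \<noteq> 0" "P (x-1) \<noteq> 0" and B: "B (x-1) > 0" using nz x B_pos[of "x-1"] by (simp_all add: P_eq_0_iff)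
  have "E x = D x * B (x-1)" by (simp add: E_def D_def B_def algebra_simps)
  then have "E x / tau (x-1) = D x * P (x-1) / P x" using P B by (simp add: tau_def)
  moreover have "B x * P (x+1) = Q x * P x - D x * P (x-1)"
    using recurrence[of x] x by simp
  then have "B x * P (x+1) / P x = Q x - D x * P (x-1) / P x"
    using P by (simp add: diff_divide_distrib)
  ultimately show ?thesis by (simp add: tau_def)
qed

text \<open>Q is a convex quadratic symmetric about (n-2)/2, and \<open>E_antimono\<close> is the opposite monotonicity of
E about (n-1)/2.\<close>

lemma Q_strict_mono:
  assumes "x < x'" "n - 2 < x + x'" shows "Q x < Q x'"
proof -
  have "0 < (x' - x) * (x + x' - (n-2))" using assms by simp
  then show ?thesis unfolding Q_def of_int_less_iff by (simp add: algebra_simps)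
qed

lemma Q_mono: "x \<le> x' \<Longrightarrow> n - 2 < x + x' \<Longrightarrow> Q x \<le> Q x'"
  using Q_strict_mono[of x x'] by (cases "x = x'") auto

lemma E_antimono:
  assumes "0 \<le> x" "x \<le> x'" "n - 1 \<le> x + x'" "x' \<le> n - 1" shows "E x' \<le> E x"
proof -
  have "0 \<le> (x' - x) * (x + x' - (n-1))" using assms by simp
  then have inner: "x' * (n-1-x') \<le> x * (n-1-x)" and outer: "(x'+1) * (n-x') \<le> (x+1) * (n-x)"
    by (simp_all add: algebra_simps)
  have "0 \<le> x * (n-1-x)" "0 \<le> (x'+1) * (n-x')"
    by (intro mult_nonneg_nonneg; use assms in linarith)+
  with inner outer have "(x' * (n-1-x')) * ((x'+1) * (n-x')) \<le> (x * (n-1-x)) * ((x+1) * (n-x))"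
    by (rule mult_mono)
  then show ?thesis unfolding E_def of_int_le_iff by (simp add: mult_ac)
qed

lemma E_nonneg: "0 \<le> x \<Longrightarrow> x \<le> n - 1 \<Longrightarrow> 0 \<le> E x"
  by (simp add: E_def)

definition consecutive :: "int \<Rightarrow> int \<Rightarrow> bool" where
  "consecutive a b \<longleftrightarrow> a \<in> R \<and> b \<in> R \<and> a < b \<and> (\<forall>x. a < x \<and> x < b \<longrightarrow> x \<notin> R)"

lemma gap_ge_2:
  assumes "consecutive a b" shows "a + 2 \<le> b"
proof (rule ccontr)
  assume "\<not> a + 2 \<le> b"
  then have "b = a + 1" using assms by (simp add: consecutive_def)
  then show False using assms not_adjacent[of a] by (simp add: consecutive_def)
qed

text \<open>Sturm comparison: farther from the centre Q is larger and E is smaller, so the continued fraction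
started after a' stays strictly above the one started after a and cannot vanish as early.\<close>

lemma gap_strict_increase:
  assumes ab: "consecutive a b" and ab': "consecutive a' b'" and "a < a'" and centre: "n - 2 \<le> a + a'"
  shows "b - a < b' - a'"
proof (rule ccontr)
  assume "\<not> b - a < b' - a'"
  then have le: "b' - a' \<le> b - a" by simp
  have bounds: "0 \<le> a" "b \<le> n - 2" "0 \<le> a'" "b' \<le> n - 2" using ab ab' range by (auto simp: consecutive_def)
  have R: "a \<in> R" "a' \<in> R" "b' \<in> R" using ab ab' by (auto simp: consecutive_def)
  have cmp: "tau (a + 1 + int j) < tau (a' + 1 + int j)" if "a' + 1 + int j < b'" for j
    using that
  proof (induction j)
    case 0
    have "tau (a+1) = Q (a+1)" "tau (a'+1) = Q (a'+1)"
      using 0 R bounds le by (auto intro!: tau_after_root)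
    moreover have "Q (a+1) < Q (a'+1)" using \<open>a < a'\<close> centre by (intro Q_strict_mono) auto
    ultimately show ?case by simp
  next
    case (Suc j)
    define x x' where "x = a + 1 + int (Suc j)" and "x' = a' + 1 + int (Suc j)"
    have x: "a < x - 1" "x < b" "a' < x' - 1" "x' < b'" using Suc.prems le by (auto simp: x_def x'_def)
    have prev: "x - 1 = a + 1 + int j" "x' - 1 = a' + 1 + int j" by (simp_all add: x_def x'_def)
    have IH: "tau (x-1) < tau (x'-1)" unfolding prev using Suc by simp
    have notR: "x \<notin> R" "x - 1 \<notin> R" "x' \<notin> R" "x' - 1 \<notin> R" using x ab ab' by (auto simp: consecutive_def)
    have pos: "0 < tau (x-1)" using x bounds notR by (intro tau_pos) auto
    have "E x' \<le> E x" using x \<open>a < a'\<close> centre bounds by (intro E_antimono) (auto simp: x_def x'_def)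
    then have "E x' / tau (x'-1) \<le> E x / tau (x-1)"
      using IH pos x bounds by (intro frac_le E_nonneg) auto
    moreover have "Q x < Q x'" using \<open>a < a'\<close> centre by (intro Q_strict_mono) (auto simp: x_def x'_def)
    ultimately have "tau x < tau x'" using x bounds notR by (simp add: tau_step)
    then show ?case by (simp only: x_def x'_def)
  qed
  define j where "j = nat (b' - a' - 2)"
  have j: "int j = b' - a' - 2" using gap_ge_2[OF ab'] by (simp add: j_def)
  have "tau (a + 1 + int j) < tau (a' + 1 + int j)" using j by (intro cmp) simp
  moreover have "tau (a' + 1 + int j) = 0" using j R by (intro tau_before_root) simp
  moreover have "0 \<le> tau (a + 1 + int j)" using j le bounds by (intro tau_nonneg) simp
  ultimately show False by simp
qed

text \<open>The difference Q(x-1)Q(x)-4E(x) factors as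
(n-s)(n-s-1)((2x-n+1)^2-(n-1+s(2n-1-s))). Once it is nonnegative it stays so, and then
the step \<tau> \<mapsto> Q-E/\<tau> preserves \<tau> \<ge> Q/2, so no further zero can follow. Here
x=a+2 is the first point at which the continued fraction makes a step after the zero a.\<close>

lemma non_oscillation_bound:
  assumes ab: "consecutive a b" and gap: "a + 3 \<le> b" and centre: "n - 2 \<le> 2 * a"
  shows "(2*a - (n-2) + 3)\<^sup>2 < n - 1 + s * (2*n-1-s)"
proof (rule ccontr)
  assume neg: "\<not> (2*a - (n-2) + 3)\<^sup>2 < n - 1 + s * (2*n-1-s)"
  have bounds: "0 \<le> a" "b \<le> n - 2" and R: "a \<in> R" "b \<in> R" using ab range by (auto simp: consecutive_def)
  have "0 \<le> (n - s) * (n - s - 1) * ((2*a - (n-2) + 3)\<^sup>2 - (n - 1 + s * (2*n-1-s)))"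
    using neg sn by simp
  also have "\<dots> = ((n-1-(a+1)) * (n-2-(a+1)) + (a+1) * ((a+1)+1) - s * (2*n-1-s)) *
     ((n-1-(a+2)) * (n-2-(a+2)) + (a+2) * ((a+2)+1) - s * (2*n-1-s)) -
     4 * ((a+2) * ((a+2)+1) * ((n-(a+2)) * (n-1-(a+2))))"
    by (simp add: power2_eq_square algebra_simps)
  finally have "real_of_int (4 * ((a+2) * ((a+2)+1) * ((n-(a+2)) * (n-1-(a+2))))) \<le> real_of_int (
     ((n-1-(a+1)) * (n-2-(a+1)) + (a+1) * ((a+1)+1) - s * (2*n-1-s)) *
     ((n-1-(a+2)) * (n-2-(a+2)) + (a+2) * ((a+2)+1) - s * (2*n-1-s)))"
    unfolding of_int_le_iff by simp
  then have "4 * E (a+2) \<le> Q (a+1) * Q (a+2)"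
    unfolding E_def Q_def by (simp only: of_int_mult of_int_numeral)
  have first: "tau (a+1) = Q (a+1)" using R gap bounds by (intro tau_after_root) auto
  have Qpos: "0 < Q (a+1)"
    unfolding first[symmetric] using ab gap bounds by (intro tau_pos) (auto simp: consecutive_def)
  have half: "Q (a + 1 + int j) / 2 \<le> tau (a + 1 + int j)" if "a + 1 + int j < b" for j
    using that
  proof (induction j)
    case 0 then show ?case using first Qpos by simp
  next
    case (Suc j)
    define x where "x = a + 1 + int (Suc j)"
    have x: "a < x - 1" "x < b" using Suc.prems by (auto simp: x_def)
    have notR: "x \<notin> R" "x - 1 \<notin> R" using x ab by (auto simp: consecutive_def)
    have prev: "x - 1 = a + 1 + int j" by (simp add: x_def)
    have IH: "Q (x-1) / 2 \<le> tau (x-1)" unfolding prev using Suc by simp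
    have Q1: "Q (a+1) \<le> Q (x-1)" and Q2: "Q (a+2) \<le> Q x"
      using x centre by (auto intro!: Q_mono)
    have "E x \<le> E (a+2)" using x bounds centre by (intro E_antimono) (auto simp: x_def)
    then have "4 * E x \<le> Q (a+1) * Q (a+2)" using \<open>4 * E (a+2) \<le> _\<close> by simp
    also have "\<dots> \<le> Q (x-1) * Q x"
    proof (intro mult_mono Q1 Q2)
      show "0 \<le> Q (a+2)" using Q_strict_mono[of "a+1" "a+2"] Qpos centre by simp
    qed (use Q1 Qpos in simp)
    finally have "E x \<le> Q x / 2 * (Q (x-1) / 2)" by (simp add: mult_ac)
    also have "\<dots> \<le> Q x / 2 * tau (x-1)"
      using IH Q2 Q_strict_mono[of "a+1" "a+2"] Qpos centre by (intro mult_left_mono) simp_all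
    finally have "E x / tau (x-1) \<le> Q x / 2"
      using IH Q1 Qpos by (simp add: divide_le_eq)
    then have "Q x / 2 \<le> tau x" using x bounds notR by (simp add: tau_step)
    then show ?case by (simp only: x_def)
  qed
  define j where "j = nat (b - a - 2)"
  have j: "int j = b - a - 2" using gap by (simp add: j_def)
  have "Q (a + 1 + int j) / 2 \<le> tau (a + 1 + int j)" using j by (intro half) simp
  moreover have "tau (a + 1 + int j) = 0" using j R by (intro tau_before_root) simp
  moreover have "Q (a+1) < Q (a + 1 + int j)" using j gap centre by (intro Q_strict_mono) auto
  ultimately show False using Qpos by simp
qed

text \<open>List the zeros in increasing order with k=s div 2. By reflection the zero of index
k is not left of the centre; the gap after it is at least 2 and later gaps grow by at least one
each. Summing the m gaps up to the second largest zero bounds its distance from the centre from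
below, and the oscillation bound limits the same distance from above.\<close>

lemma root_spread:
  assumes s: "s \<ge> 4" and m: "m = s - 2 - s div 2"
  shows "(m\<^sup>2 + 3 * m + 3)\<^sup>2 < n - 1 + s * (2*n-1-s)"
proof -
  define xs where "xs = sorted_list_of_set R"
  define S where "S = card R"
  have xs: "set xs = R" "length xs = S" "sorted_wrt (<) xs"
    using fin by (auto simp: xs_def S_def)
  have S: "int S = s" "4 \<le> S" using card s by (auto simp: S_def)
  have less: "xs ! i < xs ! j" if "i < j" "j < S" for i j
    using sorted_wrt_nth_less[OF xs(3)] that xs(2) by blast
  have le: "xs ! i \<le> xs ! j" if "i \<le> j" "j < S" for i j
    using less[of i j] that by (cases "i = j") auto
  have cons: "consecutive (xs ! i) (xs ! Suc i)" if i: "Suc i < S" for i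
    unfolding consecutive_def
  proof (intro conjI allI impI notI)
    show "xs ! i \<in> R" "xs ! Suc i \<in> R" using i xs by (metis nth_mem Suc_lessD)+
    show "xs ! i < xs ! Suc i" using less[of i "Suc i"] i by simp
    fix x assume x: "xs ! i < x \<and> x < xs ! Suc i" and "x \<in> R"
    then obtain l where l: "l < S" "x = xs ! l" using xs by (metis in_set_conv_nth)
    show False
    proof (cases "l \<le> i")
      case True then show ?thesis using le[of l i] x l i by simp
    next
      case False then show ?thesis using le[of "Suc i" l] x l by simp
    qed
  qed
  have mirror: "xs ! i + xs ! (S - 1 - i) = n - 2" if i: "i < S" for i
  proof -
    have "rev (map (\<lambda>x. n - 2 - x) xs) = xs"
    proof (rule sorted_distinct_set_unique)
      have "sorted_wrt (\<lambda>x y. n - 2 - y < n - 2 - x) xs" using xs(3) by simp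
      then have "sorted_wrt (<) (rev (map (\<lambda>x. n - 2 - x) xs))"
        by (simp add: sorted_wrt_rev sorted_wrt_map)
      then show "sorted (rev (map (\<lambda>x. n - 2 - x) xs))" "distinct (rev (map (\<lambda>x. n - 2 - x) xs))"
        by (simp_all only: strict_sorted_iff)
      show "sorted xs" "distinct xs" using xs(3) by (simp_all only: strict_sorted_iff)
      have "(\<lambda>x. n - 2 - x) ` R = R"
      proof (intro equalityI subsetI)
        fix x assume "x \<in> R"
        then show "x \<in> (\<lambda>x. n - 2 - x) ` R" using reflect by (intro image_eqI[of _ _ "n - 2 - x"]) auto
      qed (use reflect in auto)
      then show "set (rev (map (\<lambda>x. n - 2 - x) xs)) = set xs" using xs(1) by simp
    qed
    then have "rev (map (\<lambda>x. n - 2 - x) xs) ! i = xs ! i" by simp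
    then show ?thesis using i xs(2) by (simp add: rev_nth)
  qed
  have past_centre: "n - 2 \<le> xs ! i + xs ! j" if "S \<le> i + j + 1" "i < S" "j < S" for i j
  proof -
    have "S - 1 - j \<le> i" using that by linarith
    then show ?thesis using mirror[of j] le[of "S - 1 - j" i] that by simp
  qed
  define k where "k = S div 2"
  have gaps: "2 + int j \<le> xs ! Suc (k + j) - xs ! (k + j)" if "Suc (k + j) < S" for j
    using that
  proof (induction j)
    case 0 then show ?case using gap_ge_2[OF cons[of k]] by simp
  next
    case (Suc j)
    have "xs ! Suc (k+j) - xs ! (k+j) < xs ! Suc (Suc (k+j)) - xs ! Suc (k+j)"
      using Suc.prems less[of "k+j" "Suc (k+j)"]
      by (intro gap_strict_increase cons past_centre) (auto simp: k_def)
    then show ?case using Suc by simp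
  qed
  have sum: "n - 2 + (int j)\<^sup>2 + 3 * int j \<le> 2 * xs ! (k + j)" if "k + j < S" for j
    using that
  proof (induction j)
    case 0 then show ?case using past_centre[of k k] by (simp add: k_def)
  next
    case (Suc j)
    then have "2 + int j \<le> xs ! Suc (k + j) - xs ! (k + j)" using gaps[of j] by simp
    then show ?case using Suc by (simp add: power2_eq_square algebra_simps)
  qed
  define a where "a = xs ! (S - 2)"
  have "k + (S - 2 - k) = S - 2" "int (S - 2 - k) = m"
    using S m by (auto simp: k_def of_nat_diff zdiv_int)
  then have a: "n - 2 + m\<^sup>2 + 3 * m \<le> 2 * a" using sum[of "S - 2 - k"] S by (simp add: a_def)
  have m0: "0 \<le> m" using s m by linarith
  then have a_centre: "n - 2 \<le> 2 * a" using a zero_le_power2[of m] by linarith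
  have "consecutive (xs ! (S-3)) (xs ! (S-2))" "consecutive a (xs ! (S-1))"
    using cons[of "S-3"] cons[of "S-2"] S by (auto simp: a_def Suc_diff_Suc numeral_eq_Suc)
  \<comment> \<open>the last gap exceeds the one before it, hence is at least 3\<close>
  moreover from this have "xs ! (S-2) - xs ! (S-3) < xs ! (S-1) - a"
    using S less[of "S-3" "S-2"] past_centre[of "S-3" "S-2"]
    by (intro gap_strict_increase) (auto simp: a_def)
  ultimately have "(2*a - (n-2) + 3)\<^sup>2 < n - 1 + s * (2*n-1-s)"
    using gap_ge_2[of "xs ! (S-3)" "xs ! (S-2)"] a_centre
    by (intro non_oscillation_bound) auto
  moreover have "(m\<^sup>2 + 3 * m + 3)\<^sup>2 \<le> (2*a - (n-2) + 3)\<^sup>2"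
    using a m0 by (intro power_mono) auto
  ultimately show ?thesis by simp
qed

end

section \<open>Arithmetic of the coefficients\<close>

text \<open>Here r stands for n-s. The four congruences are the consequences of the integrality of the first
four coefficients for the pair (s,r), and the last inequality is the one of \<open>root_spread\<close>. Nested
conditionals let the evaluation stop at the first congruence that fails.\<close>

lemma small_parameters_excluded:
  "\<forall>s\<in>set [4..27]. \<forall>r\<in>set [2..3*s*(s-1) div 4].
     if (3*s*(s-1) :: int) mod (2*r+1) = 0 then
     if (s*(s-1)*((r-1)*r*(r+1))) mod (4*(2*r+1)) = 0 then
     if (s*(s-1)*(s-2)*(s-3)*((r-1)*r*(r+1))*((r+1)*(r+2)*(r+2)*(r+3))) mod (48*(2*r+1)*(2*r+2)*(2*r+3)) = 0 then
     if s*(r-1) mod 2 = 0 then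
     \<not> ((s-2-s div 2)^2 + 3*(s-2-s div 2) + 3)^2 < (r+s) - 1 + s*(2*(r+s)-1-s) else True else True else True else True"
  by code_simp

text \<open>With r of order s^2 the left side is of order s^3 and the right side of order s^4; in terms of
v=s-28 the difference of suitable multiples is a polynomial with positive coefficients.\<close>

lemma degree_bound_from_spread:
  fixes r s :: int
  assumes s: "s \<ge> 28" and r: "2 * (2*r+1) \<le> 3*s*(s-1)"
  shows "r + s - 1 + s * (2*(r+s)-1-s) \<le> ((s-2-s div 2)\<^sup>2 + 3*(s-2-s div 2) + 3)\<^sup>2"
proof -
  define v where "v = s - 28"
  define m where "m = s - 2 - s div 2"
  have v: "0 \<le> v" "s = v + 28" using s by (auto simp: v_def)
  have m: "v + 24 \<le> 2 * m" unfolding m_def v_def by presburger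
  have "(v+24)\<^sup>2 \<le> (2*m)\<^sup>2" using m v by (intro power_mono) auto
  then have "(v+24)\<^sup>2 + 6*(v+24) + 12 \<le> 4 * (m\<^sup>2 + 3*m + 3)"
    using m by (simp add: power_mult_distrib)
  then have "((v+24)\<^sup>2 + 6*(v+24) + 12)\<^sup>2 \<le> (4 * (m\<^sup>2 + 3*m + 3))\<^sup>2"
    using v by (intro power_mono) auto
  moreover have "4 * (4 * (r + s - 1 + s * (2*(r+s)-1-s))) \<le> ((v+24)\<^sup>2 + 6*(v+24) + 12)\<^sup>2"
  proof -
    have "4 * (r + s - 1 + s * (2*(r+s)-1-s)) = (4*r) * (1 + 2*s) + 4*s\<^sup>2 - 4"
      by (simp add: power2_eq_square algebra_simps)
    also have "\<dots> \<le> (3*s*(s-1) - 2) * (1 + 2*s) + 4*s\<^sup>2 - 4"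
      using r s by (simp add: mult_right_mono)
    finally have "4 * (4 * (r + s - 1 + s * (2*(r+s)-1-s))) \<le> 4 * ((3*s*(s-1) - 2) * (1 + 2*s) + 4*s\<^sup>2 - 4)"
      by simp
    also have "\<dots> \<le> ((v+24)\<^sup>2 + 6*(v+24) + 12)\<^sup>2"
    proof -
      have "((v+24)\<^sup>2 + 6*(v+24) + 12)\<^sup>2 - 4 * ((3*s*(s-1) - 2) * (1 + 2*s) + 4*s\<^sup>2 - 4) =
         v^4 + 84 * v^3 + 2360 * v\<^sup>2 + 22412 * v + 6648"
        unfolding v(2) by (simp add: power2_eq_square power3_eq_cube power4_eq_xxxx algebra_simps)
      moreover have "0 \<le> v^4 + 84 * v^3 + 2360 * v\<^sup>2 + 22412 * v + 6648" using v by simp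
      ultimately show ?thesis by linarith
    qed
    finally show ?thesis .
  qed
  moreover have "(4 * (m\<^sup>2 + 3*m + 3))\<^sup>2 = 16 * (m\<^sup>2 + 3*m + 3)\<^sup>2"
    unfolding power_mult_distrib by simp
  ultimately have "16 * (r + s - 1 + s * (2*(r+s)-1-s)) \<le> 16 * (m\<^sup>2 + 3*m + 3)\<^sup>2"
    by linarith
  then show ?thesis by (simp add: m_def)
qed

text \<open>The hypotheses on A_1,...,A_4 are the coefficient recursion. Modulo 2r+1 one has
8(r-1)r(r+1) \<equiv> 3, so the second coefficient yields 2r+1 divides 3s(s-1); this bounds r, then
s, and leaves the finite check. For s=2 and s=3 this divisibility and the
parity of the first coefficient already decide.\<close>

lemma integral_coefficients_contradiction:
  fixes r s A1 A2 A3 A4 :: int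
  assumes s: "2 \<le> s" and r: "2 \<le> r"
    and A1: "- (2*r) * A1 = s * r * (r-1)"
    and A2: "- 2 * (2*r+1) * A2 = A1 * ((s-1) * (r+1) * r)"
    and A3: "4 \<le> s \<Longrightarrow> - 3 * (2*r+2) * A3 = A2 * ((s-2) * (r+2) * (r+1))"
    and A4: "4 \<le> s \<Longrightarrow> - 4 * (2*r+3) * A4 = A3 * ((s-3) * (r+3) * (r+2))"
    and spread: "4 \<le> s \<Longrightarrow> ((s-2-s div 2)\<^sup>2 + 3*(s-2-s div 2) + 3)\<^sup>2 < (r+s) - 1 + s*(2*(r+s)-1-s)"
  shows False
proof -
  have "r * (- 2 * A1) = r * (s * (r-1))" using A1 by (simp add: algebra_simps)
  then have a1: "- 2 * A1 = s * (r-1)" using r by (simp only: mult_cancel_left) simp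
  then have "s * (r-1) = 2 * (- A1)" by simp
  then have even1: "s * (r-1) mod 2 = 0" by (metis mod_mult_self1_is_0)
  have "4 * (2*r+1) * A2 = (- 2 * A1) * ((s-1) * (r+1) * r)" using A2 by (simp add: algebra_simps)
  then have a2: "4 * (2*r+1) * A2 = s*(s-1)*((r-1)*r*(r+1))" unfolding a1 by (simp add: algebra_simps)
  have "(2*r+1) * (32 * A2 - s*(s-1)*(4*r\<^sup>2 - 2*r - 3)) =
     8 * (4 * (2*r+1) * A2) - s*(s-1)*((2*r+1)*(4*r\<^sup>2 - 2*r - 3))" by (simp add: algebra_simps)
  also have "\<dots> = 3*s*(s-1)" unfolding a2 by (simp add: power2_eq_square algebra_simps)
  finally have dvd: "(2*r+1) dvd 3*s*(s-1)" by (metis dvd_triv_left)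
  obtain t where t: "s*(s-1) = 2*t" using evenE[of "s*(s-1)"] by auto
  have "0 < s*(s-1)" using s by (intro mult_pos_pos) auto
  then have t0: "0 < t" using t by simp
  have "coprime (2*r+1) 2" by simp
  moreover have "(2*r+1) dvd 2 * (3*t)" using dvd t by (simp add: mult.assoc)
  ultimately have "(2*r+1) dvd 3*t" using coprime_dvd_mult_right_iff by blast
  then have le: "2*r+1 \<le> 3*t" using t0 by (intro zdvd_imp_le) auto
  then have bound: "2*(2*r+1) \<le> 3*s*(s-1)" using t by (simp add: mult.assoc)
  show False
  proof (cases "4 \<le> s")
    case True
    have "48*(2*r+1)*(2*r+2)*(2*r+3)*A4 = - 12*(2*r+1)*(2*r+2) * (- 4 * (2*r+3) * A4)"
      by (simp add: algebra_simps)
    also have "\<dots> = 4 * (2*r+1) * (- 3 * (2*r+2) * A3) * ((s-3) * (r+3) * (r+2))"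
      unfolding A4[OF True] by (simp add: algebra_simps)
    also have "\<dots> = (4 * (2*r+1) * A2) * ((s-2) * (r+2) * (r+1)) * ((s-3) * (r+3) * (r+2))"
      unfolding A3[OF True] by (simp add: algebra_simps)
    also have "\<dots> = s*(s-1)*(s-2)*(s-3)*((r-1)*r*(r+1))*((r+1)*(r+2)*(r+2)*(r+3))"
      unfolding a2 by (simp only: mult_ac)
    finally have a4: "s*(s-1)*(s-2)*(s-3)*((r-1)*r*(r+1))*((r+1)*(r+2)*(r+2)*(r+3)) =
      48*(2*r+1)*(2*r+2)*(2*r+3)*A4" by simp
    have s27: "s \<le> 27" using degree_bound_from_spread[OF _ bound] spread[OF True] by linarith
    have s_range: "s \<in> set [4..27]" unfolding set_upto using True s27 by simp
    have r_range: "r \<in> set [2..3*s*(s-1) div 4]" unfolding set_upto using r bound by simp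
    show False
      using small_parameters_excluded[THEN bspec, OF s_range, THEN bspec, OF r_range] dvd even1 spread[OF True]
      by (simp only: a2[symmetric] a4 mod_mult_self1_is_0 dvd_eq_mod_eq_0 if_True simp_thms)
  next
    case False
    then have "s = 2 \<or> s = 3" using s by linarith
    then show False
    proof
      assume "s = 2"
      then show False using le t r by simp
    next
      assume "s = 3"
      then have "(2*r+1) dvd 9" using \<open>(2*r+1) dvd 3*t\<close> t by simp
      moreover have "r \<le> 4" using le t \<open>s = 3\<close> by simp
      then have "r = 2 \<or> r = 3 \<or> r = 4" using r by linarith
      ultimately show False using even1 \<open>s = 3\<close> by (elim disjE) simp_all
    qed
  qed
qed

section \<open>The degree of a tight code\<close>

lemma tight_code_degree:
  assumes n: "n \<ge> 1" and s: "s \<ge> 1" and C: "tight_symmetric_inner_distribution_code n s C"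
  shows "s = 1 \<or> s = n - 1"
proof (rule ccontr)
  assume neg: "\<not> (s = 1 \<or> s = n - 1)"
  obtain R where R: "finite R" "card R = s" "R \<subseteq> {..n-2}" and n2: "n \<ge> 2" and sn: "s \<le> n - 1"
    and reflect: "\<And>r. r \<in> R \<Longrightarrow> n - 2 - r \<in> R"
    and orth: "\<And>i. i < s \<Longrightarrow> (\<Sum>x\<le>n-2. real ((n-1) choose x) * real ((n-1) choose Suc x) *
        ((\<Prod>l<i. real x - real l) * (\<Prod>r\<in>R. real x - real r))) = 0"
    using tight_code_intersection_polynomial[OF n s C] by blast
  have s2: "2 \<le> s" and sn2: "s + 2 \<le> n" using neg s sn by auto
  define p where "p x = (\<Prod>r\<in>R. x - real r)" for x
  obtain a :: "nat \<Rightarrow> int" where a: "a s = 1" "\<And>x. p x = (\<Sum>j\<le>s. of_int (a j) * falling j x)"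
    using integer_roots_falling_expansion[OF R(1)] unfolding p_def R(2) by metis
  have p_orth: "(\<Sum>x\<le>n-2. hahn_weight n x * (p x * falling i x)) = 0" if "i < s" for i
    using orth[OF that] by (simp add: hahn_weight_def p_def falling_def mult_ac)
  note eigen = orthogonal_polynomial_eigenfunction[OF n2 sn a(2) p_orth]

  \<comment> \<open>The coefficient recursion runs downwards from the leading coefficient.\<close>
  define A where "A i = a (s - i)" for i
  define r where "r = int n - int s"
  have rec: "- int i * (2*r + int i - 1) * A i = A (i - 1) * ((int s - int i + 1) * (r + int i - 1) * (r + int i - 2))"
    if i: "1 \<le> i" "i \<le> s" for i
  proof -
    define j where "j = s - i"
    have j: "j < s" "real j = real s - real i" using i by (auto simp: j_def of_nat_diff)
    have A: "A i = a j" "A (i - 1) = a (Suc j)" using i by (auto simp: A_def j_def Suc_diff_le)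
    have "real_of_int (- int i * (2*r + int i - 1) * A i) =
       (real j * (2 * real n - 1 - real j) - real s * (2 * real n - 1 - real s)) * a j"
      unfolding A r_def j(2) by (simp add: algebra_simps)
    also have "\<dots> = a (Suc j) * (real (Suc j) * (real n - real (Suc j)) * (real n - real (Suc j) - 1))"
      by (rule eigen(2)[OF _ j(1)])
    also have "\<dots> = real_of_int (A (i - 1) * ((int s - int i + 1) * (r + int i - 1) * (r + int i - 2)))"
      unfolding A r_def of_nat_Suc j(2) by (simp add: algebra_simps)
    finally show ?thesis by (simp only: of_int_eq_iff)
  qed

  define R' where "R' = int ` R"
  have card': "int (card R') = int s" using R(2) by (simp add: R'_def card_image)
  have p_int: "(\<Prod>r\<in>R'. real_of_int (x - r)) = p (of_int x)" for x
    by (simp add: R'_def p_def prod.reindex)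
  interpret roots: integral_hahn_roots "int n" "int s" R' "\<lambda>x. \<Prod>r\<in>R'. real_of_int (x - r)"
    "\<lambda>x. of_int ((int n - 1 - x) * (int n - 2 - x))" "\<lambda>x. of_int (x * (x+1))"
    "\<lambda>x. of_int ((int n - 1 - x) * (int n - 2 - x) + x * (x+1) - int s * (2 * int n - 1 - int s))"
    "\<lambda>x. of_int (x * (x+1) * ((int n - x) * (int n - 1 - x)))"
  proof unfold_locales
    show "finite R'" using R by (simp add: R'_def)
    show "int (card R') = int s" by (rule card')
    show "int s + 2 \<le> int n" using sn2 by simp
    show "R' \<subseteq> {0..int n - 2}" using R(3) n2 by (auto simp: R'_def)
    show "int n - 2 - r \<in> R'" if r: "r \<in> R'" for r
    proof -
      obtain q where q: "q \<in> R" "r = int q" using r by (auto simp: R'_def)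
      then have "int (n - 2 - q) = int n - 2 - r" using R(3) n2 by auto
      then show ?thesis using reflect[OF q(1)] by (metis R'_def imageI)
    qed
    show "real_of_int ((int n - 1 - x) * (int n - 2 - x)) * (\<Prod>r\<in>R'. real_of_int (x + 1 - r)) +
        real_of_int (x * (x + 1)) * (\<Prod>r\<in>R'. real_of_int (x - 1 - r)) =
        real_of_int ((int n - 1 - x) * (int n - 2 - x) + x * (x + 1) - int s * (2 * int n - 1 - int s)) *
        (\<Prod>r\<in>R'. real_of_int (x - r))"
      if "0 \<le> x" "x \<le> int n - 2" for x
    proof -
      define y where "y = nat x"
      have y: "x = int y" "y \<le> n - 2" using that n2 by (auto simp: y_def)
      have "hahn_op n p (real y) = - real s * (2 * real n - 1 - real s) * p (real y)"
        by (rule eigen(1)[OF _ y(2)])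
      then show ?thesis unfolding p_int y(1) hahn_op_def by (simp add: algebra_simps)
    qed
  qed auto
  have "False"
  proof (rule integral_coefficients_contradiction[of "int s" r "A 1" "A 2" "A 3" "A 4"])
    show "2 \<le> int s" "2 \<le> r" using s2 sn2 by (auto simp: r_def)
    show "- (2*r) * A 1 = int s * r * (r-1)"
      using rec[of 1] s2 a(1) by (simp add: A_def algebra_simps)
    show "- 2 * (2*r+1) * A 2 = A 1 * ((int s-1) * (r+1) * r)"
      using rec[of 2] s2 by (simp add: algebra_simps)
    show "- 3 * (2*r+2) * A 3 = A 2 * ((int s-2) * (r+2) * (r+1))" if "4 \<le> int s"
      using rec[of 3] that by (simp add: algebra_simps)
    show "- 4 * (2*r+3) * A 4 = A 3 * ((int s-3) * (r+3) * (r+2))" if "4 \<le> int s"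
      using rec[of 4] that by (simp add: algebra_simps)
    show "((int s-2-int s div 2)\<^sup>2 + 3*(int s-2-int s div 2) + 3)\<^sup>2 < (r+int s) - 1 + int s*(2*(r+int s)-1-int s)"
      if "4 \<le> int s"
      using roots.root_spread[OF that refl] by (simp add: r_def)
  qed
  then show False .
qed

theorem corollary1p7:
  fixes n s :: nat
  assumes "n \<ge> 1" and "s \<ge> 1"
    and "\<exists>C. tight_symmetric_inner_distribution_code n s C"
  shows "(s = 1 \<or> s = n - 1 \<or> real s > 0.9999995 * real n) \<and>
         (n \<le> 4000000 \<longrightarrow> s = 1 \<or> s = n - 1)"
  using tight_code_degree[OF assms(1,2)] assms(3) by blast

end
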